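(* Let $\theta\in(-1,0)$, $r=1$, put $\alpha=-1/\theta$, so that $\alpha>1$, and let $\{Z_n\}_{n\ge0}$ be a (defective) GW$^{\,\theta}$-process with parameters $(\theta,1,a_n,c_n)_{n\ge1}$. Then $$q=1-(A+C)^{\alpha},\quad q_\Delta=C^{\alpha},\quad Q=1-(A+C)^{\alpha}+C^{\alpha},$$ where $A=\lim_{n\to\infty}A_n\in[0,1)$ and $C=\lim_{n\to\infty}C_n$ satisfies $0<C\le1-A$. (i) If $A=0$, then $q=1-q_\Delta=1-C^{\alpha}$, $Q=1$, and $$A_n^{-1}\mathrm{P}(\tau>n)\to\alpha C^{\alpha-1}.$$ Moreover, $$\mathrm{E}(s^{Z_n}|\tau>n)\to1-(1-s)^{1/\alpha},\quad 0\le s\le1.$$ (ii) If $A\in(0,1)$, then $Q<1$, $$\mathrm{E}(Z_n;\tau_\Delta>n)=\infty,$$ and $Z_n$ converges almost surely to a random variable $Z_\infty$ taking values in the set $\{\Delta,0,1,2,\ldots\}$, with $$\mathrm{P}(Z_\infty=\Delta)=C^{\alpha},$$ $$\mathrm{E}(s^{Z_\infty};Z_\infty\ne\Delta)=1-(A(1-s)^{1/\alpha}+C)^{\alpha},\quad 0\le s\le1.$$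
   Context: All limits are as $n\to\infty$. Let $\theta\in(-1,0)$, $r=1$, and let $(a_n,c_n)_{n\ge1}$ be real sequences with $0<a_n<1$ and $0<c_n\le1-a_n$ for all $n\ge1$. Put $$f_n(s)=1-(a_n(1-s)^{-\theta}+c_n)^{-1/\theta},\quad 0\le s\le1,$$ so that $f_n(1)=1-c_n^{-1/\theta}<1$. Each $f_n(s)=\sum_{j\ge0}p_n(j)s^j$ is a defective probability generating function: $p_n(j)\ge0$ and $f_n(1)<1$. The GW$^{\,\theta}$-process with parameters $(\theta,1,a_n,c_n)_{n\ge1}$ is the Galton-Watson process in a varying environment with $Z_0=1$, in which each individual of generation $n-1$, independently of everything else, has $j$ offspring with probability $p_n(j)$, $j\ge0$, and with the remaining probability $1-f_n(1)$ sends the entire process to an additional absorbing state $\Delta$ at time $n$ (so $Z_n=\Delta$ if some individual of generation $n-1$ does so, or if $Z_{n-1}=\Delta$; otherwise $Z_n$ is the total number of offspring). The state $0$ is also absorbing. With $F_n=f_1\circ\cdots\circ f_n$, one has $\mathrm{E}(s^{Z_n};Z_n\ne\Delta)=F_n(s)$, $\mathrm{P}(Z_n=0)=F_n(0)$, $\mathrm{P}(Z_n=\Delta)=1-F_n(1)$. Notation: $\mathrm{E}(X;E)$ is the expectation of $X$ times the indicator of the event $E$. $\tau_0$ and $\tau_\Delta$ are the absorption times at $0$ and at $\Delta$ respectively, $\tau=\min(\tau_0,\tau_\Delta)$, $q=\mathrm{P}(\tau_0<\infty)$, $q_\Delta=\mathrm{P}(\tau_\Delta<\infty)$, $Q=\mathrm{P}(\tau<\infty)=q+q_\Delta$.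 $A_0=1$, $A_n=\prod_{i=1}^na_i$, $C_n=\sum_{i=1}^nA_{i-1}c_i$. *)

theory Defs
  imports "HOL-Probability.Probability"
begin

text \<open>
  States are elements of \<open>nat option\<close>: \<open>None\<close> is the additional absorbing
  state \<open>\<Delta>\<close>, and \<open>Some k\<close> stands for \<open>k\<close> living individuals. Sequences
  indexed by \<open>n \<ge> 1\<close> are functions on \<open>nat\<close> whose value at \<open>0\<close> is never used.
\<close>

text \<open>
  \<open>X n i\<close> is the offspring number of individual \<open>i\<close> of generation \<open>n - 1\<close>, with
  value \<open>None\<close> if that individual sends the whole process to \<open>\<Delta>\<close> at time \<open>n\<close>.
  Since all values of \<open>X n i\<close> are in \<open>nat option\<close>, this happens with the
  remaining probability \<open>1 - (\<Sum>j. p n j)\<close>.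
\<close>

definition defective_GWVE ::
  "'a measure \<Rightarrow> (nat \<Rightarrow> nat \<Rightarrow> real) \<Rightarrow> (nat \<Rightarrow> 'a \<Rightarrow> nat option) \<Rightarrow> bool" where
  "defective_GWVE M p Z \<longleftrightarrow>
     prob_space M \<and>
     (\<exists>X :: nat \<Rightarrow> nat \<Rightarrow> 'a \<Rightarrow> nat option.
        prob_space.indep_vars M (\<lambda>_. count_space UNIV) (\<lambda>(n, i). X n i) ({1..} \<times> UNIV) \<and>
        (\<forall>n\<ge>1. \<forall>i j. measure M {\<omega> \<in> space M. X n i \<omega> = Some j} = p n j) \<and>
        (\<forall>\<omega>\<in>space M. Z 0 \<omega> = Some 1) \<and>
        (\<forall>n\<ge>1. \<forall>\<omega>\<in>space M.
           Z n \<omega> =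
             (case Z (n - 1) \<omega> of
                None \<Rightarrow> None
              | Some k \<Rightarrow>
                  if \<exists>i<k. X n i \<omega> = None then None
                  else Some (\<Sum>i<k. the (X n i \<omega>)))))"

definition gw_f :: "real \<Rightarrow> (nat \<Rightarrow> real) \<Rightarrow> (nat \<Rightarrow> real) \<Rightarrow> nat \<Rightarrow> real \<Rightarrow> real" where
  "gw_f \<theta> a c n s = 1 - (a n * (1 - s) powr (- \<theta>) + c n) powr (- 1 / \<theta>)"

text \<open>
  The case \<open>r = 1\<close> of the \<open>GW\<^sup>\<theta>\<close>-process with parameters \<open>(\<theta>, r, a\<^sub>n, c\<^sub>n)\<close>. The
  power series expansion of \<open>gw_f \<theta> a c n\<close> determines \<open>p n\<close> uniquely for \<open>n \<ge> 1\<close>.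
\<close>

definition GW_theta ::
  "'a measure \<Rightarrow> real \<Rightarrow> (nat \<Rightarrow> real) \<Rightarrow> (nat \<Rightarrow> real) \<Rightarrow> (nat \<Rightarrow> 'a \<Rightarrow> nat option) \<Rightarrow> bool" where
  "GW_theta M \<theta> a c Z \<longleftrightarrow>
     (\<exists>p :: nat \<Rightarrow> nat \<Rightarrow> real.
        (\<forall>n\<ge>1. \<forall>j. 0 \<le> p n j) \<and>
        (\<forall>n\<ge>1. \<forall>s\<in>{0..1}. (\<lambda>j. p n j * s ^ j) sums gw_f \<theta> a c n s) \<and>
        defective_GWVE M p Z)"

definition gw_A :: "(nat \<Rightarrow> real) \<Rightarrow> nat \<Rightarrow> real" where
  "gw_A a n = (\<Prod>i=1..n. a i)"

definition gw_C :: "(nat \<Rightarrow> real) \<Rightarrow> (nat \<Rightarrow> real) \<Rightarrow> nat \<Rightarrow> real" where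
  "gw_C a c n = (\<Sum>i=1..n. gw_A a (i - 1) * c i)"

text \<open>The infimum of the empty set is \<open>\<infinity>\<close> in \<open>enat\<close>.\<close>

definition hitting_time :: "(nat \<Rightarrow> 'a \<Rightarrow> nat option) \<Rightarrow> nat option \<Rightarrow> 'a \<Rightarrow> enat" where
  "hitting_time Z x \<omega> = (INF n\<in>{n. Z n \<omega> = x}. enat n)"

definition tau_0 :: "(nat \<Rightarrow> 'a \<Rightarrow> nat option) \<Rightarrow> 'a \<Rightarrow> enat" where
  "tau_0 Z = hitting_time Z (Some 0)"

definition tau_Delta :: "(nat \<Rightarrow> 'a \<Rightarrow> nat option) \<Rightarrow> 'a \<Rightarrow> enat" where
  "tau_Delta Z = hitting_time Z None"

definition tau :: "(nat \<Rightarrow> 'a \<Rightarrow> nat option) \<Rightarrow> 'a \<Rightarrow> enat" where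
  "tau Z \<omega> = min (tau_0 Z \<omega>) (tau_Delta Z \<omega>)"

end

theory Submission
  imports Defs
begin

text \<open>
  The composition \<open>F\<^sub>n = f\<^sub>1 \<circ> \<dots> \<circ> f\<^sub>n\<close> is explicit,
  \<open>F\<^sub>n(s) = 1 - (A\<^sub>n (1 - s) powr (1/\<alpha>) + C\<^sub>n) powr \<alpha>\<close>, and by the branching property it is the
  defective generating function of \<open>Z\<^sub>n\<close>. The absorption probabilities are the limits of
  \<open>F\<^sub>n(0)\<close> and \<open>1 - F\<^sub>n(1)\<close>; the asymptotics for \<open>A = 0\<close> and the infinite mean come from
  mean value bounds for \<open>x powr \<alpha>\<close> at \<open>C\<^sub>n\<close>.

  If \<open>A > 0\<close>, then \<open>\<Sum>(1 - a\<^sub>n)\<close> converges, and so does \<open>\<Sum>(1 - p\<^sub>n(1))\<close>. The process can leave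
  state \<open>k\<close> at time \<open>n\<close> only if one of \<open>k\<close> individuals does not have exactly one child, so by
  Borel-Cantelli every state is almost surely left finitely often. Hence \<open>Z\<^sub>n\<close> is
  eventually constant or tends to infinity, and continuity of \<open>lim F\<^sub>n\<close> at \<open>1\<close> excludes
  the latter.
\<close>

section \<open>Powers and their difference quotients\<close>

text \<open>The mean value theorem writes the difference as
  \<open>\<alpha> z powr (\<alpha> - 1)\<close> times \<open>u - v\<close> for some \<open>z\<close>
  between \<open>v\<close> and \<open>u\<close>. Since \<open>\<alpha> - 1\<close> is nonnegative,
  this slope lies between its values at the two ends.\<close>

lemma powr_diff_bounds:
  fixes u v \<alpha> :: real
  assumes "0 < v" "v \<le> u" "1 \<le> \<alpha>"
  shows "\<alpha> * v powr (\<alpha> - 1) * (u - v) \<le> u powr \<alpha> - v powr \<alpha>"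
    and "u powr \<alpha> - v powr \<alpha> \<le> \<alpha> * u powr (\<alpha> - 1) * (u - v)"
proof -
  have "\<exists>z. v \<le> z \<and> z \<le> u \<and> u powr \<alpha> - v powr \<alpha> = (u - v) * (\<alpha> * z powr (\<alpha> - 1))"
  proof (cases "v = u")
    case False
    with assms have "v < u" by simp
    then have "\<exists>z. v < z \<and> z < u \<and> u powr \<alpha> - v powr \<alpha> = (u - v) * (\<alpha> * z powr (\<alpha> - 1))"
      using assms by (intro MVT2) (auto intro!: derivative_eq_intros)
    then show ?thesis by (meson less_imp_le)
  qed auto
  then obtain z where z: "v \<le> z" "z \<le> u" "u powr \<alpha> - v powr \<alpha> = (u - v) * (\<alpha> * z powr (\<alpha> - 1))"
    by blast
  have "v powr (\<alpha> - 1) \<le> z powr (\<alpha> - 1)" "z powr (\<alpha> - 1) \<le> u powr (\<alpha> - 1)"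
    using z assms by (auto intro!: powr_mono2)
  then have "(u - v) * (\<alpha> * v powr (\<alpha> - 1)) \<le> (u - v) * (\<alpha> * z powr (\<alpha> - 1))"
    "(u - v) * (\<alpha> * z powr (\<alpha> - 1)) \<le> (u - v) * (\<alpha> * u powr (\<alpha> - 1))"
    using assms by (auto intro!: mult_left_mono)
  then show "\<alpha> * v powr (\<alpha> - 1) * (u - v) \<le> u powr \<alpha> - v powr \<alpha>"
    "u powr \<alpha> - v powr \<alpha> \<le> \<alpha> * u powr (\<alpha> - 1) * (u - v)"
    unfolding z(3) by (simp_all only: mult_ac)
qed

text \<open>The base point \<open>C n\<close> moves with \<open>n\<close>, so this is not a plain
  derivative. The quotient is squeezed between the slopes at \<open>C n\<close> and at
  \<open>A n * x + C n\<close>, and both of these points tend to \<open>c\<close>.\<close>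

lemma powr_difference_quotient_tendsto:
  fixes A C :: "nat \<Rightarrow> real" and c x \<alpha> :: real
  assumes "1 \<le> \<alpha>" "0 \<le> x" "A \<longlonglongrightarrow> 0" "C \<longlonglongrightarrow> c" "0 < c" "\<And>n. 0 < A n"
  shows "(\<lambda>n. ((A n * x + C n) powr \<alpha> - C n powr \<alpha>) / A n) \<longlonglongrightarrow> \<alpha> * c powr (\<alpha> - 1) * x"
proof (rule tendsto_sandwich)
  \<comment> \<open>Only eventual positivity is available: in the application \<open>C 0\<close> is
    \<open>0\<close>.\<close>
  have ev: "\<forall>\<^sub>F n in sequentially. 0 < C n"
    using assms(4,5) by (rule order_tendstoD)
  show "\<forall>\<^sub>F n in sequentially. \<alpha> * C n powr (\<alpha> - 1) * x \<le> ((A n * x + C n) powr \<alpha> - C n powr \<alpha>) / A n"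
    using ev
  proof eventually_elim
    case (elim n)
    show ?case
      using powr_diff_bounds(1)[of "C n" "A n * x + C n" \<alpha>] elim assms(1,2) assms(6)[of n]
      by (simp add: field_simps)
  qed
  show "\<forall>\<^sub>F n in sequentially. ((A n * x + C n) powr \<alpha> - C n powr \<alpha>) / A n \<le> \<alpha> * (A n * x + C n) powr (\<alpha> - 1) * x"
    using ev
  proof eventually_elim
    case (elim n)
    show ?case
      using powr_diff_bounds(2)[of "C n" "A n * x + C n" \<alpha>] elim assms(1,2) assms(6)[of n]
      by (simp add: field_simps)
  qed
  show "(\<lambda>n. \<alpha> * C n powr (\<alpha> - 1) * x) \<longlonglongrightarrow> \<alpha> * c powr (\<alpha> - 1) * x"
    using assms by (auto intro!: tendsto_intros)
  have "(\<lambda>n. A n * x + C n) \<longlonglongrightarrow> 0 * x + c"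
    by (intro tendsto_intros assms)
  then have "(\<lambda>n. \<alpha> * (A n * x + C n) powr (\<alpha> - 1) * x) \<longlonglongrightarrow> \<alpha> * (0 * x + c) powr (\<alpha> - 1) * x"
    using assms(5) by (intro tendsto_mult tendsto_powr tendsto_const) auto
  then show "(\<lambda>n. \<alpha> * (A n * x + C n) powr (\<alpha> - 1) * x) \<longlonglongrightarrow> \<alpha> * c powr (\<alpha> - 1) * x"
    by simp
qed

lemma one_minus_powr_le:
  fixes a \<alpha> :: real
  assumes "0 < a" "a \<le> 1" "1 \<le> \<alpha>"
  shows "1 - a powr \<alpha> \<le> \<alpha> * (1 - a)"
  using powr_diff_bounds(2)[of a 1 \<alpha>] assms by simp

text \<open>
  The coefficient is \<open>f'(0) = a (a + c) powr (\<alpha> - 1)\<close> for the sum \<open>f\<close> of the series. Only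
  \<open>s \<in> [0, 1]\<close> is available, so it is estimated through right difference quotients at \<open>0\<close>.
\<close>

lemma power_series_coeff_1_ge:
  fixes a c \<alpha> :: real and p :: "nat \<Rightarrow> real"
  assumes "1 < \<alpha>" "0 < a" "0 < c" "a + c \<le> 1" and p: "\<And>j. 0 \<le> p j"
    and sums: "\<And>s. s \<in> {0..1} \<Longrightarrow> (\<lambda>j. p j * s ^ j) sums (1 - (a * (1 - s) powr (1/\<alpha>) + c) powr \<alpha>)"
  shows "a powr \<alpha> \<le> p 1"
proof -
  define f where "f s = 1 - (a * (1 - s) powr (1/\<alpha>) + c) powr \<alpha>" for s
  \<comment> \<open>The terms of order at least 2 contribute at most \<open>s^2\<close> at
    \<open>s\<close>, because their coefficients sum to at most 1. Hence \<open>p 1 + s\<close>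
    bounds the difference quotient of \<open>f\<close> on \<open>[0, s]\<close>, which the mean
    value bound estimates from below.\<close>
  have lower: "a * (a * (1 - s) powr (1/\<alpha>)) powr (\<alpha> - 1) - s \<le> p 1" if s: "0 < s" "s < 1" for s
  proof -
    have p0: "p 0 = f 0"
      using sums_unique2[OF sums[of 0, unfolded f_def[symmetric]]] powser_sums_zero[of p]
      by simp
    have S1: "p sums f 1"
      using sums[of 1] by (simp add: f_def)
    have "f 1 \<le> 1" by (simp add: f_def)
    have S1': "(\<lambda>j. p (j + 2)) sums (f 1 - p 0 - p 1)"
      using sums_split_initial_segment[OF S1, of 2] by (simp add: numeral_2_eq_2 diff_diff_eq)
    have Ss': "(\<lambda>j. p (j + 2) * s ^ (j + 2)) sums (f s - p 0 - p 1 * s)"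
      using sums_split_initial_segment[OF sums[of s, unfolded f_def[symmetric]], of 2] s
      by (simp add: numeral_2_eq_2 diff_diff_eq)
    have "f s - p 0 - p 1 * s \<le> s\<^sup>2 * (f 1 - p 0 - p 1)"
    proof (rule sums_le[OF _ Ss' sums_mult[OF S1']])
      fix j
      have "p (j + 2) * s ^ (j + 2) = s\<^sup>2 * (p (j + 2) * s ^ j)"
        by (simp add: power_add power2_eq_square)
      also have "\<dots> \<le> s\<^sup>2 * (p (j + 2) * 1)"
        using s p by (intro mult_left_mono) (auto simp: power_le_one)
      finally show "p (j + 2) * s ^ (j + 2) \<le> s\<^sup>2 * p (j + 2)" by simp
    qed
    also have "\<dots> \<le> s\<^sup>2 * 1"
      using p[of 0] p[of 1] \<open>f 1 \<le> 1\<close> by (intro mult_left_mono) auto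
    finally have upper: "f s - f 0 \<le> s * (p 1 + s)"
      by (simp add: p0 power2_eq_square algebra_simps)
    define v where "v = a * (1 - s) powr (1/\<alpha>) + c"
    have v: "0 < v" using assms s by (auto simp: v_def intro!: add_nonneg_pos)
    \<comment> \<open>The graph of the concave power lies below its tangent at \<open>s = 0\<close>.
      This is \<open>one_minus_powr_le\<close> at \<open>1 - s / \<alpha>\<close>, with the root
      taken through logarithms.\<close>
    have le1: "(1 - s) powr (1/\<alpha>) \<le> 1 - s / \<alpha>"
    proof -
      have "ln (1 - s) \<le> \<alpha> * ln (1 - s / \<alpha>)"
      proof -
        have "(1 - s) \<le> (1 - s / \<alpha>) powr \<alpha>"
          using one_minus_powr_le[of "1 - s / \<alpha>" \<alpha>] s assms by (simp add: field_simps)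
        moreover have "0 < 1 - s / \<alpha>" using s assms by (simp add: field_simps)
        ultimately show ?thesis
          using s by (metis diff_gt_0_iff_gt ln_le_cancel_iff ln_powr powr_gt_zero order_less_irrefl)
      qed
      then have "(1 / \<alpha>) * ln (1 - s) \<le> ln (1 - s / \<alpha>)"
        using assms by (simp add: field_simps)
      moreover have "0 < 1 - s / \<alpha>" using s assms by (simp add: field_simps)
      ultimately show ?thesis
        using s by (simp add: powr_def ln_ge_iff)
    qed
    have uv: "a * (s / \<alpha>) \<le> (a + c) - v"
      using mult_left_mono[OF le1, of a] assms by (simp add: v_def algebra_simps)
    \<comment> \<open>Dropping \<open>c\<close> from \<open>v\<close> weakens the bound, so that its
      limit for \<open>s\<close> tending to 0 is \<open>a powr \<alpha>\<close>, a function of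
      \<open>a\<close> alone.\<close>
    have "s * (a * (a * (1 - s) powr (1/\<alpha>)) powr (\<alpha> - 1)) \<le> s * (a * v powr (\<alpha> - 1))"
      using assms s by (intro mult_left_mono powr_mono2) (auto simp: v_def)
    also have "\<dots> = \<alpha> * v powr (\<alpha> - 1) * (a * (s / \<alpha>))"
      using assms by simp
    also have "\<dots> \<le> \<alpha> * v powr (\<alpha> - 1) * ((a + c) - v)"
      using uv assms by (intro mult_left_mono) auto
    also have "\<dots> \<le> (a + c) powr \<alpha> - v powr \<alpha>"
    proof (rule powr_diff_bounds)
      have "0 \<le> a * (s / \<alpha>)" using assms s by auto
      then show "v \<le> a + c" using uv by linarith
    qed (use v assms in auto)
    also have "\<dots> = f s - f 0" by (simp add: f_def v_def)
    also note upper
    finally show ?thesis using s by (simp add: mult_le_cancel_left_pos)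
  qed
  have lim: "((\<lambda>s. a * (a * (1 - s) powr (1/\<alpha>)) powr (\<alpha> - 1) - s) \<longlongrightarrow> a * (a * (1 - 0) powr (1/\<alpha>)) powr (\<alpha> - 1) - 0) (at_right 0)"
    by (intro tendsto_intros) (use assms in auto)
  have "a * (a * (1 - 0) powr (1/\<alpha>)) powr (\<alpha> - 1) - 0 \<le> p 1"
  proof (rule tendsto_upperbound[OF lim])
    show "\<forall>\<^sub>F s in at_right 0. a * (a * (1 - s) powr (1/\<alpha>)) powr (\<alpha> - 1) - s \<le> p 1"
      by (rule eventually_mono[OF eventually_at_right_real[of 0 1]]) (use lower in auto)
  qed simp
  also have "a * (a * (1 - 0) powr (1/\<alpha>)) powr (\<alpha> - 1) - 0 = a powr \<alpha>"
    using assms by (simp add: powr_diff)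
  finally show ?thesis .
qed

section \<open>The parameters\<close>

lemma gw_A_Suc: "gw_A a (Suc n) = gw_A a n * a (Suc n)"
  by (simp add: gw_A_def)

lemma gw_C_Suc: "gw_C a c (Suc n) = gw_C a c n + gw_A a n * c (Suc n)"
  by (simp add: gw_C_def)

lemma gw_A_0 [simp]: "gw_A a 0 = 1" and gw_C_0 [simp]: "gw_C a c 0 = 0"
  by (simp_all add: gw_A_def gw_C_def)

locale gw_parameters =
  fixes \<alpha> :: real and a c :: "nat \<Rightarrow> real"
  assumes \<alpha>: "1 < \<alpha>"
    and a: "\<And>n. 1 \<le> n \<Longrightarrow> 0 < a n \<and> a n < 1"
    and c: "\<And>n. 1 \<le> n \<Longrightarrow> 0 < c n \<and> c n \<le> 1 - a n"
begin

abbreviation "Alim \<equiv> lim (gw_A a)"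
abbreviation "Clim \<equiv> lim (gw_C a c)"

lemma A_pos: "0 < gw_A a n"
  using a by (auto simp: gw_A_def intro!: prod_pos)

lemma A_decseq: "decseq (gw_A a)"
proof (rule decseq_SucI)
  fix n show "gw_A a (Suc n) \<le> gw_A a n"
    using A_pos[of n] a[of "Suc n"] by (simp add: gw_A_Suc mult_le_cancel_left1)
qed

lemma C_incseq: "incseq (gw_C a c)"
proof (rule incseq_SucI)
  fix n show "gw_C a c n \<le> gw_C a c (Suc n)"
    using A_pos[of n] c[of "Suc n"] by (simp add: gw_C_Suc)
qed

lemma C_pos: "1 \<le> n \<Longrightarrow> 0 < gw_C a c n"
  using incseqD[OF C_incseq, of 1 n] c[of 1] gw_C_Suc[of a c 0] by simp

text \<open>The increment is \<open>gw_A a n\<close> times \<open>a (Suc n) + c (Suc n) - 1\<close>,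
  which is at most 0. As the sum starts at 1, this bounds \<open>gw_C\<close> and gives the limit
  inequality for \<open>Clim\<close>.\<close>

lemma A_plus_C_decseq: "decseq (\<lambda>n. gw_A a n + gw_C a c n)"
proof (rule decseq_SucI)
  fix n
  have "gw_A a n * (a (Suc n) + c (Suc n)) \<le> gw_A a n * 1"
    using A_pos[of n] c[of "Suc n"] by (intro mult_left_mono) auto
  then show "gw_A a (Suc n) + gw_C a c (Suc n) \<le> gw_A a n + gw_C a c n"
    by (simp add: gw_C_Suc gw_A_Suc algebra_simps)
qed

lemma A_plus_C_le_1: "gw_A a n + gw_C a c n \<le> 1"
  using decseqD[OF A_plus_C_decseq, of 0 n] by simp

lemma A_lim: "gw_A a \<longlonglongrightarrow> Alim"
proof -
  obtain L where "gw_A a \<longlonglongrightarrow> L"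
    using decseq_convergent[OF A_decseq, of 0] A_pos by (metis less_imp_le)
  then show ?thesis by (simp add: limI)
qed

lemma C_lim: "gw_C a c \<longlonglongrightarrow> Clim"
proof -
  have "gw_C a c n \<le> 1" for n
    using A_plus_C_le_1[of n] A_pos[of n] by simp
  then obtain L where "gw_C a c \<longlonglongrightarrow> L"
    using incseq_convergent[OF C_incseq, of 1] by metis
  then show ?thesis by (simp add: limI)
qed

lemma A_lim_nonneg: "0 \<le> Alim"
  using LIMSEQ_le_const[OF A_lim, of 0] A_pos less_imp_le by blast

lemma A_ge_lim: "Alim \<le> gw_A a n"
  using decseq_ge[OF A_decseq A_lim] .

lemma A_lim_less_1: "Alim < 1"
  using A_ge_lim[of 1] a[of 1] gw_A_Suc[of a 0] by simp

lemma C_lim_pos: "0 < Clim"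
  using incseq_le[OF C_incseq C_lim, of 1] C_pos[of 1] by simp

lemma A_plus_C_lim_le: "Clim \<le> 1 - Alim"
  using LIMSEQ_le_const2[OF tendsto_add[OF A_lim C_lim], of 1] A_plus_C_le_1 by auto

section \<open>Closed form of the iterated generating functions\<close>

definition F :: "nat \<Rightarrow> real \<Rightarrow> real" where
  "F n s = 1 - (gw_A a n * (1 - s) powr (1/\<alpha>) + gw_C a c n) powr \<alpha>"

lemma F_lim: "(\<lambda>n. F n s) \<longlonglongrightarrow> 1 - (Alim * (1 - s) powr (1/\<alpha>) + Clim) powr \<alpha>"
proof -
  have "0 < Alim * (1 - s) powr (1/\<alpha>) + Clim"
    using A_lim_nonneg C_lim_pos by (auto intro!: add_nonneg_pos)
  then show ?thesis
    unfolding F_def by (intro tendsto_intros A_lim C_lim) auto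
qed

text \<open>In the coordinate \<open>x = (1 - s) powr (1/\<alpha>)\<close> the generating function
  of one generation is the affine map taking \<open>x\<close> to \<open>a x + c\<close>. The newest
  generation is innermost, so \<open>A x + C\<close> becomes \<open>A (a x + c) + C\<close>.\<close>

lemma F_Suc:
  assumes "s \<in> {0..1}"
  shows "F (Suc n) s = F n (1 - (a (Suc n) * (1 - s) powr (1/\<alpha>) + c (Suc n)) powr \<alpha>)"
proof -
  have "0 < a (Suc n) * (1 - s) powr (1/\<alpha>) + c (Suc n)"
    using a[of "Suc n"] c[of "Suc n"] by (auto intro!: add_nonneg_pos)
  then show ?thesis
    using \<alpha> by (simp add: F_def powr_powr gw_A_Suc gw_C_Suc algebra_simps)
qed

text \<open>The decrement of \<open>gw_A\<close> at step \<open>n\<close> is \<open>gw_A a n\<close>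
  times \<open>1 - a (Suc n)\<close>, hence at least \<open>Alim\<close> times it, and the
  decrements telescope.\<close>

lemma summable_one_minus_a:
  assumes "0 < Alim"
  shows "summable (\<lambda>n. 1 - a (Suc n))"
proof (rule summable_comparison_test')
  show "summable (\<lambda>n. (gw_A a n - gw_A a (Suc n)) / Alim)"
    using telescope_summable'[OF A_lim] by (rule summable_divide)
  fix n
  have "1 - a (Suc n) = (gw_A a n - gw_A a (Suc n)) / gw_A a n"
    using A_pos[of n] by (simp add: gw_A_Suc field_simps)
  also have "\<dots> \<le> (gw_A a n - gw_A a (Suc n)) / Alim"
    using assms A_ge_lim[of n] A_pos[of n] decseqD[OF A_decseq, of n "Suc n"]
    by (intro divide_left_mono) auto
  finally show "norm (1 - a (Suc n)) \<le> (gw_A a n - gw_A a (Suc n)) / Alim"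
    using a[of "Suc n"] by simp
qed

section \<open>Infinite left slope of the iterates at \<open>1\<close>\<close>

lemma F_diff_ge:
  assumes "1 \<le> n" "s < 1"
  shows "\<alpha> * gw_C a c n powr (\<alpha> - 1) * gw_A a n * (1 - s) powr (1/\<alpha>) \<le> F n 1 - F n s"
  using powr_diff_bounds(1)[of "gw_C a c n" "gw_A a n * (1 - s) powr (1/\<alpha>) + gw_C a c n" \<alpha>]
    C_pos[OF assms(1)] A_pos[of n] \<alpha> by (simp add: F_def mult_ac)

text \<open>With \<open>d = 1 - s\<close>, \<open>F_diff_ge\<close> bounds the quotient below by a
  positive constant times \<open>d powr (1/\<alpha> - 1)\<close>. The exponent is negative, so this
  blows up as \<open>d\<close> tends to 0.\<close>

lemma F_quotient_unbounded:
  assumes "1 \<le> n"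
  shows "\<exists>s. 0 < s \<and> s < 1 \<and> B \<le> (F n 1 - F n s) / (1 - s)"
proof -
  define K where "K = \<alpha> * gw_C a c n powr (\<alpha> - 1) * gw_A a n"
  have K: "0 < K" using \<alpha> A_pos[of n] C_pos[OF assms] by (auto simp: K_def)
  \<comment> \<open>\<open>d\<close> solves \<open>d powr (1/\<alpha> - 1) = y\<close>. The choice
    of \<open>y\<close> makes \<open>K * y\<close> at least \<open>B\<close>, and the lower bound 2
    forces \<open>d < 1\<close>.\<close>
  define y where "y = max 2 (B / K)"
  define d where "d = y powr (- \<alpha> / (\<alpha> - 1))"
  have y: "1 < y" by (simp add: y_def)
  have "- \<alpha> / (\<alpha> - 1) < 0" using \<alpha> by (simp add: field_simps)
  then have d: "0 < d" "d < 1"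
    using y powr_less_mono[of "- \<alpha> / (\<alpha> - 1)" 0 y] by (auto simp: d_def)
  have "(- \<alpha> / (\<alpha> - 1)) * (1 / \<alpha> - 1) = 1"
    using \<alpha> by (simp add: divide_simps)
  then have "d powr (1 / \<alpha> - 1) = y"
    using y by (simp add: d_def powr_powr)
  then have *: "d powr (1 / \<alpha>) / d = y"
    using d by (simp add: powr_diff)
  have "B \<le> K * y"
    using K by (simp add: y_def max_def field_simps)
  also have "\<dots> = (K * d powr (1/\<alpha>)) / d"
    by (simp flip: *)
  also have "\<dots> \<le> (F n 1 - F n (1 - d)) / d"
    using F_diff_ge[OF assms, of "1 - d"] d by (intro divide_right_mono) (auto simp: K_def)
  finally show ?thesis
    using d by (intro exI[of _ "1 - d"]) auto
qed

end

section \<open>Defective branching processes in varying environment\<close>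

text \<open>With \<open>s ^ \<Delta> = 0\<close>, the defective generating function of \<open>Z\<^sub>n\<close> is the expectation of \<open>opow s Z\<^sub>n\<close>.\<close>

definition opow :: "real \<Rightarrow> nat option \<Rightarrow> real" where
  "opow s z = (case z of None \<Rightarrow> 0 | Some k \<Rightarrow> s ^ k)"

lemma opow_simps [simp]: "opow s None = 0" "opow s (Some k) = s ^ k"
  by (simp_all add: opow_def)

lemma measurable_opow [measurable]: "opow s \<in> borel_measurable (count_space UNIV)"
  by simp

lemma opow_bounds:
  assumes "s \<in> {0..1}"
  shows "0 \<le> opow s z" "opow s z \<le> 1" "\<bar>opow s z\<bar> \<le> 1"
  using assms by (auto simp: opow_def power_le_one split: option.split)

lemma opow_mono: "0 \<le> s \<Longrightarrow> s \<le> t \<Longrightarrow> opow s z \<le> opow t z"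
  by (auto simp: opow_def power_mono split: option.split)

definition offspring_total :: "nat \<Rightarrow> (nat \<Rightarrow> nat option) \<Rightarrow> nat option" where
  "offspring_total k x = (if \<exists>i<k. x i = None then None else Some (\<Sum>i<k. the (x i)))"

text \<open>One individual sending the process to \<Delta> annihilates the product, which matches
  the convention that \<open>opow s None\<close> is 0. Otherwise a power of a sum is a product of
  powers.\<close>

lemma opow_offspring_total: "opow s (offspring_total k x) = (\<Prod>i<k. opow s (x i))"
proof (cases "\<exists>i<k. x i = None")
  case True
  then have "(\<Prod>i<k. opow s (x i)) = 0"
    by (force intro!: prod_zero)
  with True show ?thesis by (simp add: offspring_total_def)
next
  case False
  then have "(\<Prod>i<k. opow s (x i)) = (\<Prod>i<k. s ^ the (x i))"
    by (intro prod.cong) auto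
  then show ?thesis unfolding offspring_total_def if_not_P[OF False] by (simp add: power_sum)
qed

lemma measurable_sum_count_space:
  fixes f :: "nat \<Rightarrow> 'a \<Rightarrow> nat"
  assumes "\<And>i. i < k \<Longrightarrow> f i \<in> measurable M (count_space UNIV)"
  shows "(\<lambda>x. \<Sum>i<k. f i x) \<in> measurable M (count_space UNIV)"
  using assms
proof (induction k)
  case (Suc k)
  have [measurable]: "f k \<in> measurable M (count_space UNIV)"
    "(\<lambda>x. \<Sum>i<k. f i x) \<in> measurable M (count_space UNIV)"
    using Suc by auto
  have "(\<lambda>x. (\<lambda>m x. m + f k x) (\<Sum>i<k. f i x) x) \<in> measurable M (count_space UNIV)"
    by (rule measurable_compose_countable) measurable
  then show ?case by simp
qed simp

lemma measurable_offspring_total: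
  assumes [measurable]: "\<And>i. (\<lambda>x. f x i) \<in> measurable M (count_space UNIV)"
  shows "(\<lambda>x. offspring_total k (f x)) \<in> measurable M (count_space UNIV)"
proof -
  have [measurable]: "(\<lambda>x. \<Sum>i<k. the (f x i)) \<in> measurable M (count_space UNIV)"
    by (intro measurable_sum_count_space measurable_compose[OF assms]) simp
  show ?thesis unfolding offspring_total_def by measurable
qed

text \<open>The recursion of the process as a deterministic function of the whole offspring family.
  It shows that the state at time \<open>n\<close> depends only on generations up to
  \<open>n\<close>, which is what independence arguments need.\<close>

primrec gw_path :: "nat \<Rightarrow> (nat \<times> nat \<Rightarrow> nat option) \<Rightarrow> nat option" where
  "gw_path 0 x = Some 1"
| "gw_path (Suc n) x =
    (case gw_path n x of None \<Rightarrow> None | Some k \<Rightarrow> offspring_total k (\<lambda>i. x (Suc n, i)))"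

text \<open>The number of summands is itself random, but it takes countably many values, so
  measurability can be checked for each fixed previous state.\<close>

lemma measurable_gw_path:
  assumes "{1..n} \<times> UNIV \<subseteq> L"
  shows "gw_path n \<in> measurable (Pi\<^sub>M L (\<lambda>_. count_space UNIV)) (count_space UNIV)"
  using assms
proof (induction n)
  case 0
  have "gw_path 0 = (\<lambda>_. Some 1)" by auto
  then show ?case by simp
next
  case (Suc n)
  have "{1..n} \<times> UNIV \<subseteq> L" using Suc.prems by (force simp: subset_iff)
  note IH = Suc.IH[OF this]
  have comp: "(\<lambda>x. x (Suc n, i)) \<in> measurable (Pi\<^sub>M L (\<lambda>_. count_space UNIV)) (count_space UNIV)" for i
    using Suc.prems by (intro measurable_component_singleton) auto
  have "(\<lambda>x. (\<lambda>z x. case z of None \<Rightarrow> None | Some k \<Rightarrow> offspring_total k (\<lambda>i. x (Suc n, i))) (gw_path n x) x)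
      \<in> measurable (Pi\<^sub>M L (\<lambda>_. count_space UNIV)) (count_space UNIV)"
  proof (rule measurable_compose_countable[OF _ IH])
    fix z :: "nat option"
    show "(\<lambda>x. case z of None \<Rightarrow> None | Some k \<Rightarrow> offspring_total k (\<lambda>i. x (Suc n, i)))
      \<in> measurable (Pi\<^sub>M L (\<lambda>_. count_space UNIV)) (count_space UNIV)"
      by (cases z) (auto intro!: measurable_offspring_total comp)
  qed
  then show ?case by simp
qed

text \<open>For each outcome at most one summand is nonzero, and none if \<open>Y\<close> is
  \<open>None\<close>. The partial sums are therefore bounded by \<open>B\<close>, and dominated
  convergence allows termwise integration.\<close>

lemma (in prob_space) expectation_sums_option:
  fixes Y :: "'a \<Rightarrow> nat option" and W :: "'a \<Rightarrow> real"
  assumes [measurable]: "Y \<in> measurable M (count_space UNIV)" "W \<in> borel_measurable M"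
    and W: "\<And>\<omega>. \<bar>W \<omega>\<bar> \<le> B"
  shows "(\<lambda>k. expectation (\<lambda>\<omega>. of_bool (Y \<omega> = Some k) * W \<omega>)) sums
    expectation (\<lambda>\<omega>. if Y \<omega> = None then 0 else W \<omega>)"
proof -
  have int: "integrable M (\<lambda>\<omega>. of_bool (Y \<omega> = Some k) * W \<omega>)" for k
    by (rule integrable_const_bound[where B = B])
      (use W order_trans[OF abs_ge_zero W] in \<open>auto simp: of_bool_def\<close>)
  have partial: "(\<Sum>k<n. of_bool (Y \<omega> = Some k) * W \<omega>) =
      (case Y \<omega> of None \<Rightarrow> 0 | Some k \<Rightarrow> if k < n then W \<omega> else 0)" for n \<omega>
    by (cases "Y \<omega>") (auto simp: of_bool_def if_distrib[of "\<lambda>x. x * _"] cong: if_cong)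
  have "(\<lambda>n. expectation (\<lambda>\<omega>. \<Sum>k<n. of_bool (Y \<omega> = Some k) * W \<omega>)) \<longlonglongrightarrow>
    expectation (\<lambda>\<omega>. if Y \<omega> = None then 0 else W \<omega>)"
  proof (rule integral_dominated_convergence[where w = "\<lambda>_. B"])
    show "AE \<omega> in M. (\<lambda>n. \<Sum>k<n. of_bool (Y \<omega> = Some k) * W \<omega>) \<longlonglongrightarrow> (if Y \<omega> = None then 0 else W \<omega>)"
    proof (rule AE_I2)
      fix \<omega>
      show "(\<lambda>n. \<Sum>k<n. of_bool (Y \<omega> = Some k) * W \<omega>) \<longlonglongrightarrow> (if Y \<omega> = None then 0 else W \<omega>)"
      proof (cases "Y \<omega>")
        case (Some k)
        then have "\<forall>\<^sub>F n in sequentially. (\<Sum>k<n. of_bool (Y \<omega> = Some k) * W \<omega>) = W \<omega>"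
          unfolding partial by (auto simp: eventually_sequentially intro!: exI[of _ "Suc k"])
        with Some show ?thesis by (simp add: tendsto_eventually)
      qed simp
    qed
    show "AE \<omega> in M. norm (\<Sum>k<n. of_bool (Y \<omega> = Some k) * W \<omega>) \<le> B" for n
      unfolding partial using W order_trans[OF abs_ge_zero W] by (auto split: option.split)
  qed auto
  then show ?thesis
    by (simp only: sums_def Bochner_Integration.integral_sum[OF int])
qed

lemma hitting_time_greater_iff: "enat n < hitting_time Z x \<omega> \<longleftrightarrow> (\<forall>m\<le>n. Z m \<omega> \<noteq> x)"
proof -
  have "enat n < hitting_time Z x \<omega> \<longleftrightarrow> enat (Suc n) \<le> hitting_time Z x \<omega>"
    by (simp add: Suc_ile_eq)
  also have "\<dots> \<longleftrightarrow> (\<forall>m. Z m \<omega> = x \<longrightarrow> Suc n \<le> m)"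
    by (simp add: hitting_time_def le_INF_iff)
  also have "\<dots> \<longleftrightarrow> (\<forall>m\<le>n. Z m \<omega> \<noteq> x)"
    by (metis Suc_le_eq not_le)
  finally show ?thesis .
qed

lemma hitting_time_finite_iff: "hitting_time Z x \<omega> < \<infinity> \<longleftrightarrow> (\<exists>n. Z n \<omega> = x)"
  unfolding hitting_time_def INF_less_iff by auto

locale defective_GW = prob_space M for M :: "'a measure" +
  fixes p :: "nat \<Rightarrow> nat \<Rightarrow> real" and X :: "nat \<Rightarrow> nat \<Rightarrow> 'a \<Rightarrow> nat option"
    and Z :: "nat \<Rightarrow> 'a \<Rightarrow> nat option"
  assumes indep: "indep_vars (\<lambda>_. count_space UNIV) (\<lambda>(n, i). X n i) ({1..} \<times> UNIV)"
    and prob_X: "\<And>n i j. 1 \<le> n \<Longrightarrow> prob {\<omega> \<in> space M. X n i \<omega> = Some j} = p n j"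
    and Z_0: "\<And>\<omega>. \<omega> \<in> space M \<Longrightarrow> Z 0 \<omega> = Some 1"
    and Z_Suc: "\<And>n \<omega>. \<omega> \<in> space M \<Longrightarrow> Z (Suc n) \<omega> =
      (case Z n \<omega> of None \<Rightarrow> None | Some k \<Rightarrow> offspring_total k (\<lambda>i. X (Suc n) i \<omega>))"
begin

section \<open>Measurability and the branching property\<close>

lemma measurable_X [measurable]: "X (Suc n) i \<in> measurable M (count_space UNIV)"
  using indep unfolding indep_vars_def by force

lemma Z_eq_gw_path:
  assumes "\<omega> \<in> space M" "{1..n} \<times> UNIV \<subseteq> L"
  shows "Z n \<omega> = gw_path n (restrict (\<lambda>j. (\<lambda>(n, i). X n i) j \<omega>) L)"
  using assms(2)
proof (induction n)
  case (Suc n)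
  have "{1..n} \<times> UNIV \<subseteq> L" using Suc.prems by (force simp: subset_iff)
  moreover have "(Suc n, i) \<in> L" for i using Suc.prems by auto
  ultimately show ?case using Suc.IH by (simp add: Z_Suc[OF assms(1)] split: option.split)
qed (simp add: Z_0[OF assms(1)])

lemma measurable_Z [measurable]: "Z n \<in> measurable M (count_space UNIV)"
proof -
  have "(\<lambda>\<omega>. gw_path n (restrict (\<lambda>j. (\<lambda>(n, i). X n i) j \<omega>) ({1..n} \<times> UNIV))) \<in> measurable M (count_space UNIV)"
    by (rule measurable_compose[OF _ measurable_gw_path])
      (use indep in \<open>auto simp: indep_vars_def intro!: measurable_restrict\<close>)
  then show ?thesis
    by (subst measurable_cong[OF Z_eq_gw_path]) auto
qed

lemma integrable_opow_Z: "s \<in> {0..1} \<Longrightarrow> integrable M (\<lambda>\<omega>. opow s (Z n \<omega>))"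
  by (rule integrable_const_bound[where B = 1]) (auto simp: opow_bounds)

text \<open>The state at time \<open>n\<close> is a function of generations up to \<open>n\<close>,
  hence independent of the offspring of generation \<open>Suc n\<close>, whose members are also
  independent of each other.\<close>

lemma expectation_branching:
  fixes g :: "nat option \<Rightarrow> real"
  assumes g: "\<And>z. \<bar>g z\<bar> \<le> 1"
  shows "expectation (\<lambda>\<omega>. of_bool (Z n \<omega> = Some k) * (\<Prod>i<k. g (X (Suc n) i \<omega>))) =
    prob {\<omega> \<in> space M. Z n \<omega> = Some k} * (\<Prod>i<k. expectation (\<lambda>\<omega>. g (X (Suc n) i \<omega>)))"
proof -
  \<comment> \<open>Block 0 holds the entire past and block \<open>Suc i\<close> only individual
    \<open>i\<close> of the new generation. Functions of disjoint blocks of an independent family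
    are independent.\<close>
  define K where "K j = (case j of 0 \<Rightarrow> {1..n} \<times> UNIV | Suc i \<Rightarrow> {(Suc n, i :: nat)})" for j :: nat
  define Y where "Y j x = (case j of 0 \<Rightarrow> of_bool (gw_path n x = Some k) | Suc i \<Rightarrow> g (x (Suc n, i)))"
    for j :: nat and x
  define V where "V j \<omega> = Y j (restrict (\<lambda>j. (\<lambda>(n, i). X n i) j \<omega>) (K j))" for j \<omega>
  have V0: "V 0 \<omega> = of_bool (Z n \<omega> = Some k)" if "\<omega> \<in> space M" for \<omega>
    using Z_eq_gw_path[OF that, of n "{1..n} \<times> UNIV"] by (simp add: V_def Y_def K_def)
  have VS: "V (Suc i) = (\<lambda>\<omega>. g (X (Suc n) i \<omega>))" for i
    by (simp add: fun_eq_iff V_def Y_def K_def)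
  have "indep_vars (\<lambda>_. borel) V {..<Suc k}"
    unfolding V_def
  proof (rule indep_vars_compose2[OF indep_vars_restrict[OF indep]])
    show "K j \<subseteq> {1..} \<times> UNIV" for j
      by (auto simp: K_def split: nat.split)
    show "disjoint_family_on K {..<Suc k}"
      by (auto simp: disjoint_family_on_def K_def split: nat.split)
    fix j
    show "Y j \<in> borel_measurable (Pi\<^sub>M (K j) (\<lambda>_. count_space UNIV))"
    proof (cases j)
      case 0
      have "gw_path n \<in> measurable (Pi\<^sub>M ({1..n} \<times> UNIV) (\<lambda>_. count_space UNIV)) (count_space UNIV)"
        by (rule measurable_gw_path) simp
      then have "(\<lambda>x. of_bool (gw_path n x = Some k) :: real) \<in> borel_measurable (Pi\<^sub>M ({1..n} \<times> UNIV) (\<lambda>_. count_space UNIV))"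
        by (rule measurable_compose) simp
      then show ?thesis unfolding 0 K_def Y_def by simp
    next
      case (Suc i)
      have "(\<lambda>x. x (Suc n, i)) \<in> measurable (Pi\<^sub>M {(Suc n, i)} (\<lambda>_. count_space UNIV :: nat option measure)) (count_space UNIV)"
        by (intro measurable_component_singleton) auto
      then have "(\<lambda>x. g (x (Suc n, i))) \<in> borel_measurable (Pi\<^sub>M {(Suc n, i)} (\<lambda>_. count_space UNIV :: nat option measure))"
        by (rule measurable_compose) simp
      then show ?thesis unfolding Suc K_def Y_def by simp
    qed
  qed
  moreover have "integrable M (V j)" for j
  proof (rule integrable_const_bound[where B = 1])
    show "AE \<omega> in M. norm (V j \<omega>) \<le> 1"
      using g V0 VS by (cases j) auto
    show "V j \<in> borel_measurable M"
    proof (cases j)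
      case 0
      have "(\<lambda>\<omega>. of_bool (Z n \<omega> = Some k) :: real) \<in> borel_measurable M" by measurable
      then show ?thesis unfolding 0 by (subst measurable_cong[OF V0]) auto
    next
      case (Suc i)
      have "(\<lambda>\<omega>. g (X (Suc n) i \<omega>)) \<in> borel_measurable M"
        by (rule measurable_compose[OF measurable_X]) simp
      then show ?thesis unfolding Suc VS .
    qed
  qed
  ultimately have "expectation (\<lambda>\<omega>. \<Prod>j<Suc k. V j \<omega>) = (\<Prod>j<Suc k. expectation (V j))"
    by (intro indep_vars_lebesgue_integral) auto
  also have "expectation (\<lambda>\<omega>. \<Prod>j<Suc k. V j \<omega>) =
      expectation (\<lambda>\<omega>. of_bool (Z n \<omega> = Some k) * (\<Prod>i<k. g (X (Suc n) i \<omega>)))"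
    by (rule Bochner_Integration.integral_cong[OF refl])
      (simp only: prod.lessThan_Suc_shift comp_def V0 VS)
  also have "(\<Prod>j<Suc k. expectation (V j)) =
      expectation (V 0) * (\<Prod>i<k. expectation (\<lambda>\<omega>. g (X (Suc n) i \<omega>)))"
    by (simp only: prod.lessThan_Suc_shift comp_def VS)
  also have "expectation (V 0) = expectation (indicator {\<omega> \<in> space M. Z n \<omega> = Some k})"
    by (rule Bochner_Integration.integral_cong) (auto simp: V0 indicator_def)
  also have "\<dots> = prob {\<omega> \<in> space M. Z n \<omega> = Some k}"
    by simp
  finally show ?thesis .
qed

lemma expectation_opow_X:
  assumes "s \<in> {0..1}" "(\<lambda>j. p (Suc n) j * s ^ j) sums t"
  shows "expectation (\<lambda>\<omega>. opow s (X (Suc n) i \<omega>)) = t"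
proof -
  have "expectation (\<lambda>\<omega>. of_bool (X (Suc n) i \<omega> = Some j) * opow s (X (Suc n) i \<omega>)) = p (Suc n) j * s ^ j" for j
  proof -
    have "expectation (\<lambda>\<omega>. of_bool (X (Suc n) i \<omega> = Some j) * opow s (X (Suc n) i \<omega>)) =
        expectation (\<lambda>\<omega>. indicator {\<omega> \<in> space M. X (Suc n) i \<omega> = Some j} \<omega> * s ^ j)"
      by (rule Bochner_Integration.integral_cong) (auto simp: indicator_def)
    then show ?thesis by (simp add: prob_X)
  qed
  moreover have "(\<lambda>j. expectation (\<lambda>\<omega>. of_bool (X (Suc n) i \<omega> = Some j) * opow s (X (Suc n) i \<omega>))) sums
      expectation (\<lambda>\<omega>. if X (Suc n) i \<omega> = None then 0 else opow s (X (Suc n) i \<omega>))"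
    using assms by (intro expectation_sums_option[where B = 1]) (auto simp: opow_bounds)
  moreover have "(if z = None then 0 else opow s z) = opow s z" for z
    by simp
  ultimately have "(\<lambda>j. p (Suc n) j * s ^ j) sums expectation (\<lambda>\<omega>. opow s (X (Suc n) i \<omega>))"
    by simp
  then show ?thesis using assms(2) sums_unique2 by blast
qed

text \<open>Given \<open>k\<close> individuals at time \<open>n\<close>, the product over their
  offspring has mean \<open>t ^ k\<close>. Summing over \<open>k\<close> replaces \<open>s\<close>
  by \<open>t\<close>, one step of the composition.\<close>

lemma expectation_opow_Z_Suc:
  assumes s: "s \<in> {0..1}" and t: "(\<lambda>j. p (Suc n) j * s ^ j) sums t"
  shows "expectation (\<lambda>\<omega>. opow s (Z (Suc n) \<omega>)) = expectation (\<lambda>\<omega>. opow t (Z n \<omega>))"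
proof -
  \<comment> \<open>\<open>t\<close> is the mean of a variable with values in \<open>[0, 1]\<close>,
    so it lies there too and \<open>opow t\<close> is bounded.\<close>
  have "0 \<le> expectation (\<lambda>\<omega>. opow s (X (Suc n) 0 \<omega>))"
    using s by (intro Bochner_Integration.integral_nonneg) (auto simp: opow_bounds)
  moreover have "expectation (\<lambda>\<omega>. opow s (X (Suc n) 0 \<omega>)) \<le> 1"
  proof (rule integral_le_const)
    show "integrable M (\<lambda>\<omega>. opow s (X (Suc n) 0 \<omega>))"
      using s by (intro integrable_const_bound[where B = 1]) (auto simp: opow_bounds)
  qed (use s in \<open>auto simp: opow_bounds\<close>)
  ultimately have t01: "t \<in> {0..1}"
    using expectation_opow_X[OF s t] by simp
  have eq: "expectation (\<lambda>\<omega>. of_bool (Z n \<omega> = Some k) * opow s (Z (Suc n) \<omega>)) =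
      expectation (\<lambda>\<omega>. of_bool (Z n \<omega> = Some k) * opow t (Z n \<omega>))" for k
  proof -
    have "expectation (\<lambda>\<omega>. of_bool (Z n \<omega> = Some k) * opow s (Z (Suc n) \<omega>)) =
        expectation (\<lambda>\<omega>. of_bool (Z n \<omega> = Some k) * (\<Prod>i<k. opow s (X (Suc n) i \<omega>)))"
      by (rule Bochner_Integration.integral_cong) (auto simp: Z_Suc opow_offspring_total)
    also have "\<dots> = prob {\<omega> \<in> space M. Z n \<omega> = Some k} * t ^ k"
      using s by (subst expectation_branching) (auto simp: opow_bounds expectation_opow_X[OF s t])
    also have "\<dots> = expectation (\<lambda>\<omega>. indicator {\<omega> \<in> space M. Z n \<omega> = Some k} \<omega> * t ^ k)"
      by simp
    also have "\<dots> = expectation (\<lambda>\<omega>. of_bool (Z n \<omega> = Some k) * opow t (Z n \<omega>))"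
      by (rule Bochner_Integration.integral_cong) (auto simp: indicator_def)
    finally show ?thesis .
  qed
  have "(\<lambda>k. expectation (\<lambda>\<omega>. of_bool (Z n \<omega> = Some k) * opow s (Z (Suc n) \<omega>))) sums
      expectation (\<lambda>\<omega>. if Z n \<omega> = None then 0 else opow s (Z (Suc n) \<omega>))"
    using s by (intro expectation_sums_option[where B = 1]) (auto simp: opow_bounds)
  moreover have "(\<lambda>k. expectation (\<lambda>\<omega>. of_bool (Z n \<omega> = Some k) * opow t (Z n \<omega>))) sums
      expectation (\<lambda>\<omega>. if Z n \<omega> = None then 0 else opow t (Z n \<omega>))"
    using t01 by (intro expectation_sums_option[where B = 1]) (auto simp: opow_bounds)
  ultimately have "expectation (\<lambda>\<omega>. if Z n \<omega> = None then 0 else opow s (Z (Suc n) \<omega>)) =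
      expectation (\<lambda>\<omega>. if Z n \<omega> = None then 0 else opow t (Z n \<omega>))"
    unfolding eq using sums_unique2 by blast
  also have "expectation (\<lambda>\<omega>. if Z n \<omega> = None then 0 else opow s (Z (Suc n) \<omega>)) =
      expectation (\<lambda>\<omega>. opow s (Z (Suc n) \<omega>))"
    by (rule Bochner_Integration.integral_cong) (auto simp: Z_Suc)
  also have "expectation (\<lambda>\<omega>. if Z n \<omega> = None then 0 else opow t (Z n \<omega>)) =
      expectation (\<lambda>\<omega>. opow t (Z n \<omega>))"
    by (rule Bochner_Integration.integral_cong) auto
  finally show ?thesis .
qed

section \<open>Absorption, survival and the mean in a general environment\<close>

lemma Z_absorbed:
  assumes "\<omega> \<in> space M" "x = None \<or> x = Some 0" "Z m \<omega> = x" "m \<le> n"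
  shows "Z n \<omega> = x"
  using assms(4)
proof (induction n rule: dec_induct)
  case (step n)
  then show ?case
    using assms(2) by (auto simp: Z_Suc[OF assms(1)] offspring_total_def)
qed (use assms(3) in simp)

lemma hitting_time_greater_iff_Z:
  assumes "\<omega> \<in> space M" "x = None \<or> x = Some 0"
  shows "enat n < hitting_time Z x \<omega> \<longleftrightarrow> Z n \<omega> \<noteq> x"
  using Z_absorbed[OF assms] by (auto simp: hitting_time_greater_iff)

lemma tau_greater_iff:
  assumes "\<omega> \<in> space M"
  shows "enat n < tau Z \<omega> \<longleftrightarrow> Z n \<omega> \<noteq> None \<and> Z n \<omega> \<noteq> Some 0"
  using hitting_time_greater_iff_Z[OF assms] by (auto simp: tau_def tau_0_def tau_Delta_def)

text \<open>Absorption makes the events at time \<open>n\<close> increase with \<open>n\<close>, and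
  their union is the event of ever hitting \<open>x\<close>; continuity from below gives the
  limit.\<close>

lemma prob_hitting_time_finite:
  assumes "x = None \<or> x = Some 0"
  shows "(\<lambda>n. prob {\<omega> \<in> space M. Z n \<omega> = x}) \<longlonglongrightarrow> prob {\<omega> \<in> space M. hitting_time Z x \<omega> < \<infinity>}"
proof -
  have "(\<lambda>n. prob {\<omega> \<in> space M. Z n \<omega> = x}) \<longlonglongrightarrow> prob (\<Union>n. {\<omega> \<in> space M. Z n \<omega> = x})"
    using Z_absorbed[OF _ assms]
    by (intro finite_Lim_measure_incseq) (auto simp: incseq_def)
  also have "(\<Union>n. {\<omega> \<in> space M. Z n \<omega> = x}) = {\<omega> \<in> space M. hitting_time Z x \<omega> < \<infinity>}"
    unfolding hitting_time_finite_iff by auto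
  finally show ?thesis .
qed

lemma hitting_time_events:
  "{\<omega> \<in> space M. hitting_time Z x \<omega> < \<infinity>} \<in> events"
  unfolding hitting_time_finite_iff by measurable

lemma prob_tau_finite:
  "prob {\<omega> \<in> space M. tau Z \<omega> < \<infinity>} =
    prob {\<omega> \<in> space M. tau_0 Z \<omega> < \<infinity>} + prob {\<omega> \<in> space M. tau_Delta Z \<omega> < \<infinity>}"
proof -
  have disj: "\<not> (hitting_time Z (Some 0) \<omega> < \<infinity> \<and> hitting_time Z None \<omega> < \<infinity>)" if \<omega>: "\<omega> \<in> space M" for \<omega>
  proof
    assume "hitting_time Z (Some 0) \<omega> < \<infinity> \<and> hitting_time Z None \<omega> < \<infinity>"
    then obtain m n where "Z m \<omega> = Some 0" "Z n \<omega> = None"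
      unfolding hitting_time_finite_iff by auto
    then have "Z (max m n) \<omega> = Some 0" "Z (max m n) \<omega> = None"
      using Z_absorbed[OF \<omega>, of "Some 0" m "max m n"] Z_absorbed[OF \<omega>, of None n "max m n"] by auto
    then show False by simp
  qed
  have "prob ({\<omega> \<in> space M. hitting_time Z (Some 0) \<omega> < \<infinity>} \<union> {\<omega> \<in> space M. hitting_time Z None \<omega> < \<infinity>}) =
    prob {\<omega> \<in> space M. hitting_time Z (Some 0) \<omega> < \<infinity>} + prob {\<omega> \<in> space M. hitting_time Z None \<omega> < \<infinity>}"
    by (intro finite_measure_Union hitting_time_events) (use disj in blast)
  moreover have "{\<omega> \<in> space M. tau Z \<omega> < \<infinity>} =
      {\<omega> \<in> space M. hitting_time Z (Some 0) \<omega> < \<infinity>} \<union> {\<omega> \<in> space M. hitting_time Z None \<omega> < \<infinity>}"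
    unfolding tau_def tau_0_def tau_Delta_def min_less_iff_disj by blast
  ultimately show ?thesis by (simp add: tau_0_def tau_Delta_def)
qed

text \<open>As \<open>0 ^ 0 = 1\<close>, \<open>opow 0\<close> is the indicator of
  \<open>Some 0\<close>.\<close>

lemma prob_Z_eq_0: "prob {\<omega> \<in> space M. Z n \<omega> = Some 0} = expectation (\<lambda>\<omega>. opow 0 (Z n \<omega>))"
proof -
  have "expectation (\<lambda>\<omega>. opow 0 (Z n \<omega>)) = expectation (indicator {\<omega> \<in> space M. Z n \<omega> = Some 0})"
    by (rule Bochner_Integration.integral_cong) (auto simp: opow_def indicator_def power_0_left split: option.split)
  then show ?thesis by simp
qed

lemma prob_Z_eq_None: "prob {\<omega> \<in> space M. Z n \<omega> = None} = 1 - expectation (\<lambda>\<omega>. opow 1 (Z n \<omega>))"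
proof -
  have "expectation (\<lambda>\<omega>. opow 1 (Z n \<omega>)) = expectation (indicator {\<omega> \<in> space M. Z n \<omega> \<noteq> None})"
    by (rule Bochner_Integration.integral_cong) (auto simp: opow_def indicator_def split: option.split)
  then have "expectation (\<lambda>\<omega>. opow 1 (Z n \<omega>)) = prob {\<omega> \<in> space M. Z n \<omega> \<noteq> None}"
    by simp
  also have "\<dots> = 1 - prob {\<omega> \<in> space M. Z n \<omega> = None}"
    by (subst prob_compl[symmetric]) (auto intro!: arg_cong[where f = prob])
  finally show ?thesis by simp
qed

text \<open>Survival beyond \<open>n\<close> excludes \<open>None\<close>, where
  \<open>opow s\<close> vanishes anyway, and \<open>Some 0\<close>, whose contribution 1 is removed
  by subtracting \<open>opow 0\<close>.\<close>

lemma expectation_surviving: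
  assumes "s \<in> {0..1}"
  shows "(LINT \<omega>:{\<omega> \<in> space M. tau Z \<omega> > enat n}|M. s ^ the (Z n \<omega>)) =
    expectation (\<lambda>\<omega>. opow s (Z n \<omega>)) - expectation (\<lambda>\<omega>. opow 0 (Z n \<omega>))"
proof -
  have "(LINT \<omega>:{\<omega> \<in> space M. tau Z \<omega> > enat n}|M. s ^ the (Z n \<omega>)) =
      expectation (\<lambda>\<omega>. opow s (Z n \<omega>) - opow 0 (Z n \<omega>))"
    unfolding set_lebesgue_integral_def
  proof (rule Bochner_Integration.integral_cong[OF refl])
    fix \<omega> assume "\<omega> \<in> space M"
    then show "indicat_real {\<omega> \<in> space M. tau Z \<omega> > enat n} \<omega> *\<^sub>R s ^ the (Z n \<omega>) = opow s (Z n \<omega>) - opow 0 (Z n \<omega>)"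
      using tau_greater_iff[of \<omega> n]
      by (cases "Z n \<omega>") (auto simp: indicator_def power_0_left)
  qed
  also have "\<dots> = expectation (\<lambda>\<omega>. opow s (Z n \<omega>)) - expectation (\<lambda>\<omega>. opow 0 (Z n \<omega>))"
    using assms by (intro Bochner_Integration.integral_diff integrable_opow_Z) auto
  finally show ?thesis .
qed

lemma tau_greater_events: "{\<omega> \<in> space M. tau Z \<omega> > enat n} \<in> events"
proof -
  have "{\<omega> \<in> space M. tau Z \<omega> > enat n} = {\<omega> \<in> space M. Z n \<omega> \<noteq> None \<and> Z n \<omega> \<noteq> Some 0}"
    using tau_greater_iff by auto
  also have "\<dots> \<in> events" by measurable
  finally show ?thesis .
qed

lemma prob_tau_greater:
  "prob {\<omega> \<in> space M. tau Z \<omega> > enat n} =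
    expectation (\<lambda>\<omega>. opow 1 (Z n \<omega>)) - expectation (\<lambda>\<omega>. opow 0 (Z n \<omega>))"
  using expectation_surviving[of 1 n] tau_greater_events[of n]
  by (simp add: set_lebesgue_integral_def)

text \<open>By Bernoulli's inequality \<open>(1 - s ^ k) / (1 - s)\<close> is at most
  \<open>k\<close>. Integrating this gives a lower bound for the mean that makes sense even if the
  mean is infinite.\<close>

lemma mean_ge_difference_quotient:
  assumes "0 < s" "s < 1"
  shows "ennreal ((expectation (\<lambda>\<omega>. opow 1 (Z n \<omega>)) - expectation (\<lambda>\<omega>. opow s (Z n \<omega>))) / (1 - s)) \<le>
    (\<integral>\<^sup>+\<omega>\<in>{\<omega> \<in> space M. tau_Delta Z \<omega> > enat n}. of_nat (the (Z n \<omega>)) \<partial>M)"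
proof -
  have int: "integrable M (\<lambda>\<omega>. (opow 1 (Z n \<omega>) - opow s (Z n \<omega>)) / (1 - s))"
    using assms by (intro integrable_divide Bochner_Integration.integrable_diff integrable_opow_Z) auto
  have "ennreal ((expectation (\<lambda>\<omega>. opow 1 (Z n \<omega>)) - expectation (\<lambda>\<omega>. opow s (Z n \<omega>))) / (1 - s)) =
      ennreal (expectation (\<lambda>\<omega>. (opow 1 (Z n \<omega>) - opow s (Z n \<omega>)) / (1 - s)))"
    using assms by (simp add: integrable_opow_Z Bochner_Integration.integral_diff)
  also have "\<dots> = (\<integral>\<^sup>+\<omega>. ennreal ((opow 1 (Z n \<omega>) - opow s (Z n \<omega>)) / (1 - s)) \<partial>M)"
    using assms opow_mono[of s 1] by (intro nn_integral_eq_integral[symmetric] int) auto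
  also have "\<dots> \<le> (\<integral>\<^sup>+\<omega>\<in>{\<omega> \<in> space M. tau_Delta Z \<omega> > enat n}. of_nat (the (Z n \<omega>)) \<partial>M)"
  proof (rule nn_integral_mono)
    fix \<omega> assume \<omega>: "\<omega> \<in> space M"
    show "ennreal ((opow 1 (Z n \<omega>) - opow s (Z n \<omega>)) / (1 - s)) \<le>
        of_nat (the (Z n \<omega>)) * indicator {\<omega> \<in> space M. tau_Delta Z \<omega> > enat n} \<omega>"
    proof (cases "Z n \<omega>")
      case (Some k)
      have "(1 - s ^ k) / (1 - s) \<le> real k"
        using Bernoulli_inequality[of "s - 1" k] assms by (simp add: field_simps)
      then have "ennreal ((1 - s ^ k) / (1 - s)) \<le> of_nat k"
        by (simp add: ennreal_of_nat_eq_real_of_nat ennreal_leI)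
      then show ?thesis
        using Some \<omega> hitting_time_greater_iff_Z[OF \<omega>, of None n]
        by (simp add: tau_Delta_def)
    qed simp
  qed
  finally show ?thesis .
qed

lemma prob_leaves_state_le:
  "prob {\<omega> \<in> space M. Z n \<omega> = Some k \<and> Z (Suc n) \<omega> \<noteq> Some k} \<le> real k * (1 - p (Suc n) 1)"
proof -
  have "prob {\<omega> \<in> space M. Z n \<omega> = Some k \<and> Z (Suc n) \<omega> \<noteq> Some k} \<le>
      prob (\<Union>i\<in>{..<k}. {\<omega> \<in> space M. X (Suc n) i \<omega> \<noteq> Some 1})"
  proof (rule finite_measure_mono)
    show "{\<omega> \<in> space M. Z n \<omega> = Some k \<and> Z (Suc n) \<omega> \<noteq> Some k} \<subseteq>
        (\<Union>i\<in>{..<k}. {\<omega> \<in> space M. X (Suc n) i \<omega> \<noteq> Some 1})"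
    proof (rule subsetI, rule ccontr)
      fix \<omega> assume *: "\<omega> \<in> {\<omega> \<in> space M. Z n \<omega> = Some k \<and> Z (Suc n) \<omega> \<noteq> Some k}"
        "\<omega> \<notin> (\<Union>i\<in>{..<k}. {\<omega> \<in> space M. X (Suc n) i \<omega> \<noteq> Some 1})"
      then have "\<forall>i<k. X (Suc n) i \<omega> = Some 1" by auto
      then have "offspring_total k (\<lambda>i. X (Suc n) i \<omega>) = Some k" by (simp add: offspring_total_def)
      with * Z_Suc[of \<omega> n] show False by auto
    qed
  qed measurable
  also have "\<dots> \<le> (\<Sum>i<k. prob {\<omega> \<in> space M. X (Suc n) i \<omega> \<noteq> Some 1})"
    by (intro finite_measure_subadditive_finite) auto
  also have "\<dots> = (\<Sum>i<k. 1 - p (Suc n) 1)"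
  proof (rule sum.cong[OF refl])
    fix i
    have "prob {\<omega> \<in> space M. X (Suc n) i \<omega> \<noteq> Some 1} = 1 - prob {\<omega> \<in> space M. X (Suc n) i \<omega> = Some 1}"
      by (subst prob_compl[symmetric]) (auto intro!: arg_cong[where f = prob])
    then show "prob {\<omega> \<in> space M. X (Suc n) i \<omega> \<noteq> Some 1} = 1 - p (Suc n) 1"
      by (simp add: prob_X)
  qed
  finally show ?thesis by simp
qed

end

section \<open>The GW-theta process\<close>

locale GW_theta_process = gw_parameters \<alpha> a c + defective_GW M p X Z
  for \<alpha> :: real and a c :: "nat \<Rightarrow> real" and M :: "'a measure"
    and p :: "nat \<Rightarrow> nat \<Rightarrow> real" and X :: "nat \<Rightarrow> nat \<Rightarrow> 'a \<Rightarrow> nat option"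
    and Z :: "nat \<Rightarrow> 'a \<Rightarrow> nat option" +
  assumes p_nonneg: "\<And>n j. 1 \<le> n \<Longrightarrow> 0 \<le> p n j"
    and p_sums: "\<And>n s. 1 \<le> n \<Longrightarrow> s \<in> {0..1} \<Longrightarrow>
      (\<lambda>j. p n j * s ^ j) sums (1 - (a n * (1 - s) powr (1/\<alpha>) + c n) powr \<alpha>)"
begin

text \<open>The induction keeps \<open>s\<close> arbitrary because the step passes from
  \<open>s\<close> to \<open>t\<close>. That \<open>t\<close> stays in \<open>[0, 1]\<close> uses
  \<open>a (Suc n) + c (Suc n) \<le> 1\<close>.\<close>

lemma expectation_opow_Z:
  assumes "s \<in> {0..1}"
  shows "expectation (\<lambda>\<omega>. opow s (Z n \<omega>)) = F n s"
  using assms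
proof (induction n arbitrary: s)
  case 0
  have "expectation (\<lambda>\<omega>. opow s (Z 0 \<omega>)) = expectation (\<lambda>\<omega>. s)"
    by (rule Bochner_Integration.integral_cong) (auto simp: Z_0)
  then show ?case
    using 0 \<alpha> by (simp add: F_def powr_powr prob_space)
next
  case (Suc n)
  define t where "t = 1 - (a (Suc n) * (1 - s) powr (1/\<alpha>) + c (Suc n)) powr \<alpha>"
  have "a (Suc n) * (1 - s) powr (1/\<alpha>) \<le> a (Suc n) * 1"
    using Suc.prems a[of "Suc n"] \<alpha> by (intro mult_left_mono powr_le1) auto
  then have "a (Suc n) * (1 - s) powr (1/\<alpha>) + c (Suc n) \<le> 1"
    using c[of "Suc n"] by simp
  moreover have "0 \<le> a (Suc n) * (1 - s) powr (1/\<alpha>) + c (Suc n)"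
    using a[of "Suc n"] c[of "Suc n"] by simp
  ultimately have "t \<in> {0..1}"
    using \<alpha> by (simp add: t_def powr_le1)
  then show ?case
    using expectation_opow_Z_Suc[OF Suc.prems p_sums[OF _ Suc.prems]] Suc.IH[of t] F_Suc[OF Suc.prems]
    by (simp add: t_def)
qed

section \<open>Absorption probabilities, the case \<open>Alim = 0\<close>, and the infinite
  mean\<close>

lemma prob_tau_0: "prob {\<omega> \<in> space M. tau_0 Z \<omega> < \<infinity>} = 1 - (Alim + Clim) powr \<alpha>"
proof (rule LIMSEQ_unique)
  show "(\<lambda>n. F n 0) \<longlonglongrightarrow> prob {\<omega> \<in> space M. tau_0 Z \<omega> < \<infinity>}"
    using prob_hitting_time_finite[of "Some 0"]
    by (simp add: prob_Z_eq_0 expectation_opow_Z tau_0_def)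
  show "(\<lambda>n. F n 0) \<longlonglongrightarrow> 1 - (Alim + Clim) powr \<alpha>"
    using F_lim[of 0] by simp
qed

lemma prob_tau_Delta: "prob {\<omega> \<in> space M. tau_Delta Z \<omega> < \<infinity>} = Clim powr \<alpha>"
proof (rule LIMSEQ_unique)
  show "(\<lambda>n. 1 - F n 1) \<longlonglongrightarrow> prob {\<omega> \<in> space M. tau_Delta Z \<omega> < \<infinity>}"
    using prob_hitting_time_finite[of None]
    by (simp add: prob_Z_eq_None expectation_opow_Z tau_Delta_def)
  show "(\<lambda>n. 1 - F n 1) \<longlonglongrightarrow> Clim powr \<alpha>"
    using tendsto_diff[OF tendsto_const F_lim[of 1], of 1] by simp
qed

text \<open>Both values of \<open>F n\<close> are compared with the common term
  \<open>gw_C a c n powr \<alpha>\<close>, which cancels. This leaves the difference of two limits,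
  at \<open>x = 1\<close> and at \<open>x = (1 - s) powr (1/\<alpha>)\<close>.\<close>

lemma F_diff_0_asymp:
  assumes "Alim = 0" "s \<in> {0..1}"
  shows "(\<lambda>n. (F n s - F n 0) / gw_A a n) \<longlonglongrightarrow> \<alpha> * Clim powr (\<alpha> - 1) * (1 - (1 - s) powr (1/\<alpha>))"
proof -
  have lim: "(\<lambda>n. ((gw_A a n * x + gw_C a c n) powr \<alpha> - gw_C a c n powr \<alpha>) / gw_A a n) \<longlonglongrightarrow>
    \<alpha> * Clim powr (\<alpha> - 1) * x" if "0 \<le> x" for x
    using that A_lim assms(1) \<alpha> C_lim C_lim_pos A_pos
    by (intro powr_difference_quotient_tendsto) auto
  show ?thesis
    using tendsto_diff[OF lim[of 1] lim[of "(1 - s) powr (1/\<alpha>)"]]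
    by (simp add: F_def diff_divide_distrib[symmetric] algebra_simps)
qed

lemma survival_asymp:
  assumes "Alim = 0"
  shows "(\<lambda>n. inverse (gw_A a n) * prob {\<omega> \<in> space M. tau Z \<omega> > enat n}) \<longlonglongrightarrow> \<alpha> * Clim powr (\<alpha> - 1)"
  using F_diff_0_asymp[OF assms, of 1]
  by (simp add: prob_tau_greater expectation_opow_Z divide_inverse mult.commute)

text \<open>Numerator and denominator both decay like \<open>gw_A a n\<close>. After dividing by it,
  the ratio of the limits remains; the denominator is the case \<open>s = 1\<close>, with a nonzero
  limit because \<open>Clim\<close> is positive.\<close>

lemma conditional_limit:
  assumes "Alim = 0" "s \<in> {0..1}"
  shows "(\<lambda>n. (LINT \<omega>:{\<omega> \<in> space M. tau Z \<omega> > enat n}|M. s ^ the (Z n \<omega>))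
              / prob {\<omega> \<in> space M. tau Z \<omega> > enat n}) \<longlonglongrightarrow> 1 - (1 - s) powr (1/\<alpha>)"
proof -
  have K: "\<alpha> * Clim powr (\<alpha> - 1) \<noteq> 0" using \<alpha> C_lim_pos by simp
  have "(\<lambda>n. ((F n s - F n 0) / gw_A a n) / ((F n 1 - F n 0) / gw_A a n)) \<longlonglongrightarrow>
    (\<alpha> * Clim powr (\<alpha> - 1) * (1 - (1 - s) powr (1/\<alpha>))) / (\<alpha> * Clim powr (\<alpha> - 1) * (1 - (1 - 1) powr (1/\<alpha>)))"
    using K by (intro tendsto_divide F_diff_0_asymp assms) auto
  moreover have "((F n s - F n 0) / gw_A a n) / ((F n 1 - F n 0) / gw_A a n) =
    (F n s - F n 0) / (F n 1 - F n 0)" for n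
    using A_pos[of n] by simp
  ultimately have "(\<lambda>n. (F n s - F n 0) / (F n 1 - F n 0)) \<longlonglongrightarrow>
    (\<alpha> * Clim powr (\<alpha> - 1) * (1 - (1 - s) powr (1/\<alpha>))) / (\<alpha> * Clim powr (\<alpha> - 1) * (1 - (1 - 1) powr (1/\<alpha>)))"
    by (simp only:)
  then show ?thesis
    using K assms(2)
    by (simp add: expectation_surviving prob_tau_greater expectation_opow_Z)
qed

text \<open>Every difference quotient of \<open>F n\<close> at 1 is a lower bound for the mean, and
  these quotients are unbounded.\<close>

lemma infinite_mean:
  assumes "1 \<le> n"
  shows "(\<integral>\<^sup>+\<omega>\<in>{\<omega> \<in> space M. tau_Delta Z \<omega> > enat n}. of_nat (the (Z n \<omega>)) \<partial>M) = \<infinity>"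
proof (rule ccontr)
  assume "(\<integral>\<^sup>+\<omega>\<in>{\<omega> \<in> space M. tau_Delta Z \<omega> > enat n}. of_nat (the (Z n \<omega>)) \<partial>M) \<noteq> \<infinity>"
  then obtain b where b: "0 \<le> b"
    "(\<integral>\<^sup>+\<omega>\<in>{\<omega> \<in> space M. tau_Delta Z \<omega> > enat n}. of_nat (the (Z n \<omega>)) \<partial>M) = ennreal b"
    by (auto simp: less_top elim: ennreal_cases)
  obtain s where s: "0 < s" "s < 1" "b + 1 \<le> (F n 1 - F n s) / (1 - s)"
    using F_quotient_unbounded[OF assms] by blast
  have "ennreal (b + 1) \<le> ennreal ((F n 1 - F n s) / (1 - s))"
    using s by (intro ennreal_leI)
  also have "\<dots> \<le> ennreal b"
    using mean_ge_difference_quotient[OF s(1,2), of n] s(1,2) b(2) by (simp add: expectation_opow_Z)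
  finally show False using b(1) by simp
qed

section \<open>Almost sure convergence in the case \<open>0 < Alim\<close>\<close>

lemma one_minus_p_1_le: "1 - p (Suc n) 1 \<le> \<alpha> * (1 - a (Suc n))"
proof -
  have "a (Suc n) powr \<alpha> \<le> p (Suc n) 1"
    using \<alpha> a[of "Suc n"] c[of "Suc n"] p_nonneg p_sums
    by (intro power_series_coeff_1_ge[of \<alpha> "a (Suc n)" "c (Suc n)"]) auto
  moreover have "1 - a (Suc n) powr \<alpha> \<le> \<alpha> * (1 - a (Suc n))"
    using \<alpha> a[of "Suc n"] by (intro one_minus_powr_le) auto
  ultimately show ?thesis by simp
qed

text \<open>For fixed \<open>k\<close> the departure probabilities are at most
  \<open>k \<alpha>\<close> times the summable \<open>1 - a (Suc n)\<close>, so Borel-Cantelli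
  applies. The exceptional null sets for the countably many \<open>k\<close> are then
  united.\<close>

lemma AE_finitely_many_departures:
  assumes "0 < Alim"
  shows "AE \<omega> in M. \<forall>k. \<forall>\<^sub>F n in sequentially. Z n \<omega> = Some k \<longrightarrow> Z (Suc n) \<omega> = Some k"
  unfolding AE_all_countable
proof
  fix k
  have "AE \<omega> in M. \<forall>\<^sub>F n in sequentially. \<omega> \<in> space M - {\<omega> \<in> space M. Z n \<omega> = Some k \<and> Z (Suc n) \<omega> \<noteq> Some k}"
  proof (rule borel_cantelli_AE1)
    show "summable (\<lambda>n. prob {\<omega> \<in> space M. Z n \<omega> = Some k \<and> Z (Suc n) \<omega> \<noteq> Some k})"
    proof (rule summable_comparison_test')
      show "summable (\<lambda>n. real k * (\<alpha> * (1 - a (Suc n))))"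
        by (intro summable_mult summable_one_minus_a assms)
      fix n
      have "real k * (1 - p (Suc n) 1) \<le> real k * (\<alpha> * (1 - a (Suc n)))"
        by (intro mult_left_mono one_minus_p_1_le) auto
      then show "norm (prob {\<omega> \<in> space M. Z n \<omega> = Some k \<and> Z (Suc n) \<omega> \<noteq> Some k}) \<le> real k * (\<alpha> * (1 - a (Suc n)))"
        using prob_leaves_state_le[of n k] by simp
    qed
  qed (auto simp: emeasure_eq_measure)
  then show "AE \<omega> in M. \<forall>\<^sub>F n in sequentially. Z n \<omega> = Some k \<longrightarrow> Z (Suc n) \<omega> = Some k"
    by eventually_elim (auto elim!: eventually_mono)
qed

text \<open>The event that the process tends to infinity, expressed in \<open>nat option\<close> as
  eventual avoidance of \<Delta> and of each finite state.\<close>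

definition escape :: "'a set" where
  "escape = {\<omega> \<in> space M. \<forall>k. \<forall>\<^sub>F n in sequentially. Z n \<omega> \<noteq> None \<and> Z n \<omega> \<noteq> Some k}"

lemma escape_events [measurable]: "escape \<in> events"
  unfolding escape_def eventually_sequentially by measurable

lemma opow_tendsto_0_on_escape:
  assumes "\<omega> \<in> escape" "s \<in> {0<..<1}"
  shows "(\<lambda>n. opow s (Z n \<omega>)) \<longlonglongrightarrow> 0"
proof -
  \<comment> \<open>Avoiding the finitely many states below \<open>K\<close> from some time on means
    being at least \<open>K\<close> from then on.\<close>
  have ev: "\<forall>\<^sub>F n in sequentially. Z n \<omega> \<noteq> None \<and> (\<forall>k\<in>{..<K}. Z n \<omega> \<noteq> Some k)" for K
  proof (rule eventually_conj)
    show "\<forall>\<^sub>F n in sequentially. Z n \<omega> \<noteq> None"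
      using assms(1) by (auto simp: escape_def eventually_conj_iff)
    show "\<forall>\<^sub>F n in sequentially. \<forall>k\<in>{..<K}. Z n \<omega> \<noteq> Some k"
      using assms(1) by (intro eventually_ball_finite) (auto simp: escape_def eventually_conj_iff)
  qed
  have "filterlim (\<lambda>n. the (Z n \<omega>)) at_top sequentially"
    unfolding filterlim_at_top
  proof
    fix K
    show "\<forall>\<^sub>F n in sequentially. K \<le> the (Z n \<omega>)"
      using ev[of K] by eventually_elim force
  qed
  moreover have "(\<lambda>k. s ^ k) \<longlonglongrightarrow> 0"
    using assms(2) by (intro LIMSEQ_power_zero) auto
  ultimately have "(\<lambda>n. s ^ the (Z n \<omega>)) \<longlonglongrightarrow> 0"
    by (rule filterlim_compose[rotated])
  moreover have "\<forall>\<^sub>F n in sequentially. s ^ the (Z n \<omega>) = opow s (Z n \<omega>)"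
    using ev[of 0] by eventually_elim auto
  ultimately show ?thesis by (rule Lim_transform_eventually)
qed

text \<open>A single visit to \<Delta> would be permanent. Thus \<open>opow 1\<close> equals 1 on
  \<open>escape\<close> at every time, which is needed to compare integrals for each
  \<open>n\<close>.\<close>

lemma escape_not_None:
  assumes "\<omega> \<in> escape" shows "Z n \<omega> \<noteq> None"
proof
  assume "Z n \<omega> = None"
  then have "\<forall>m\<ge>n. Z m \<omega> = None"
    using assms Z_absorbed[of \<omega> None n] by (auto simp: escape_def)
  moreover obtain m where "m \<ge> n" "Z m \<omega> \<noteq> None"
    using assms by (auto simp: escape_def eventually_sequentially) (meson nle_le)
  ultimately show False by simp
qed

text \<open>
  On the escape event \<open>s ^ Z\<^sub>n\<close> tends to \<open>0\<close> for every \<open>s < 1\<close> although \<open>Z\<^sub>n \<noteq> \<Delta>\<close>, so its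
  probability is bounded by the jump at \<open>s = 1\<close> of the limiting generating function,
  and that function is continuous.
\<close>

lemma prob_escape: "prob escape = 0"
proof -
  define G where "G s = 1 - (Alim * (1 - s) powr (1/\<alpha>) + Clim) powr \<alpha>" for s
  have bound: "prob escape \<le> G 1 - G s" if s: "s \<in> {0<..<1}" for s
  proof (rule LIMSEQ_le)
    show "(\<lambda>n. F n 1 - F n s) \<longlonglongrightarrow> G 1 - G s"
      unfolding G_def by (intro tendsto_diff F_lim)
    \<comment> \<open>On \<open>escape\<close> the factor \<open>1 - opow s (Z n \<omega>)\<close>
      tends to 1, so these expectations recover \<open>prob escape\<close> by dominated
      convergence.\<close>
    have "(\<lambda>n. expectation (\<lambda>\<omega>. indicator escape \<omega> * (1 - opow s (Z n \<omega>)))) \<longlonglongrightarrow>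
        expectation (\<lambda>\<omega>. indicator escape \<omega> * 1)"
    proof (rule integral_dominated_convergence[where w = "\<lambda>_. 1"])
      have "(\<lambda>n. indicator escape \<omega> * (1 - opow s (Z n \<omega>))) \<longlonglongrightarrow> indicator escape \<omega> * 1" for \<omega>
      proof (cases "\<omega> \<in> escape")
        case True
        have "(\<lambda>n. 1 - opow s (Z n \<omega>)) \<longlonglongrightarrow> 1 - 0"
          by (intro tendsto_diff tendsto_const opow_tendsto_0_on_escape True s)
        with True show ?thesis by simp
      qed simp
      then show "AE \<omega> in M. (\<lambda>n. indicator escape \<omega> * (1 - opow s (Z n \<omega>))) \<longlonglongrightarrow> indicator escape \<omega> * (1::real)"
        by simp
      show "AE \<omega> in M. norm (indicator escape \<omega> * (1 - opow s (Z n \<omega>))) \<le> 1" for n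
        using s opow_bounds[of s] by (auto simp: indicator_def)
    qed auto
    then show "(\<lambda>n. expectation (\<lambda>\<omega>. indicator escape \<omega> * (1 - opow s (Z n \<omega>)))) \<longlonglongrightarrow> prob escape"
      by simp
    show "\<exists>N. \<forall>n\<ge>N. expectation (\<lambda>\<omega>. indicator escape \<omega> * (1 - opow s (Z n \<omega>))) \<le> F n 1 - F n s"
    proof (intro exI[of _ 0] allI impI)
      fix n
      have "expectation (\<lambda>\<omega>. indicator escape \<omega> * (1 - opow s (Z n \<omega>))) \<le>
          expectation (\<lambda>\<omega>. opow 1 (Z n \<omega>) - opow s (Z n \<omega>))"
      proof (rule integral_mono)
        show "integrable M (\<lambda>\<omega>. indicator escape \<omega> * (1 - opow s (Z n \<omega>)))"
          using s opow_bounds[of s]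
          by (intro integrable_const_bound[where B = 1]) (auto simp: indicator_def)
        show "integrable M (\<lambda>\<omega>. opow 1 (Z n \<omega>) - opow s (Z n \<omega>))"
          using s by (intro Bochner_Integration.integrable_diff integrable_opow_Z) auto
        fix \<omega>
        show "indicator escape \<omega> * (1 - opow s (Z n \<omega>)) \<le> opow 1 (Z n \<omega>) - opow s (Z n \<omega>)"
          using escape_not_None[of \<omega> n] opow_mono[of s 1 "Z n \<omega>"] s
          by (cases "\<omega> \<in> escape") auto
      qed
      also have "\<dots> = F n 1 - F n s"
        using s by (simp add: integrable_opow_Z expectation_opow_Z Bochner_Integration.integral_diff)
      finally show "expectation (\<lambda>\<omega>. indicator escape \<omega> * (1 - opow s (Z n \<omega>))) \<le> F n 1 - F n s" .
    qed
  qed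
  \<comment> \<open>The base \<open>1 - s\<close> vanishes in the limit; convergence of its power
    rests on the positive exponent and on nonnegativity to the left of 1.\<close>
  have "((\<lambda>s. 1 - s) \<longlongrightarrow> (1 - 1 :: real)) (at_left 1)"
    by (intro tendsto_intros)
  then have lim: "((\<lambda>s :: real. (1 - s) powr (1/\<alpha>)) \<longlongrightarrow> 0 powr (1/\<alpha>)) (at_left 1)"
    using \<alpha> eventually_at_left_real[of 0 "1::real"]
    by (intro tendsto_powr2) (auto elim!: eventually_mono)
  have "((\<lambda>s. G 1 - G s) \<longlongrightarrow> G 1 - (1 - (Alim * 0 powr (1/\<alpha>) + Clim) powr \<alpha>)) (at_left 1)"
    unfolding G_def using C_lim_pos
    by (intro tendsto_diff[OF tendsto_const tendsto_diff[OF tendsto_const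
      tendsto_powr[OF tendsto_add[OF tendsto_mult[OF tendsto_const lim] tendsto_const] tendsto_const]]]) auto
  then have "prob escape \<le> G 1 - (1 - (Alim * 0 powr (1/\<alpha>) + Clim) powr \<alpha>)"
    by (rule tendsto_lowerbound)
      (auto intro: eventually_mono[OF eventually_at_left_real[of 0 1]] bound)
  then have "prob escape \<le> 0" by (simp add: G_def)
  then show ?thesis by (simp add: measure_le_0_iff)
qed

lemma AE_eventually_constant:
  assumes "0 < Alim"
  shows "AE \<omega> in M. \<exists>l. \<forall>\<^sub>F n in sequentially. Z n \<omega> = l"
proof -
  have "AE \<omega> in M. \<omega> \<notin> escape"
    using prob_escape by (intro AE_not_in) (auto simp: null_sets_def emeasure_eq_measure)
  then show ?thesis
    using AE_finitely_many_departures[OF assms] AE_space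
  proof eventually_elim
    case (elim \<omega>)
    \<comment> \<open>Failure to escape gives a \<open>k\<close> such that \<Delta> or
      \<open>Some k\<close> is visited infinitely often. If \<Delta> is never visited, a visit to
      \<open>Some k\<close> after the last departure from it is permanent.\<close>
    then obtain k where k: "\<exists>\<^sub>F n in sequentially. Z n \<omega> = None \<or> Z n \<omega> = Some k"
      unfolding escape_def frequently_def by auto
    show ?case
    proof (cases "\<exists>n. Z n \<omega> = None")
      case True
      then show ?thesis
        using Z_absorbed[OF elim(3), of None] by (auto simp: eventually_sequentially)
    next
      case False
      have freq: "\<exists>\<^sub>F n in sequentially. Z n \<omega> = Some k"
        by (rule frequently_elim1[OF k]) (use False in blast)
      obtain N where N: "\<And>n. N \<le> n \<Longrightarrow> Z n \<omega> = Some k \<Longrightarrow> Z (Suc n) \<omega> = Some k"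
        using elim(2) by (auto simp: eventually_sequentially)
      obtain m where m: "N \<le> m" "Z m \<omega> = Some k"
        using freq by (auto simp: frequently_sequentially)
      have "Z n \<omega> = Some k" if "m \<le> n" for n
        using that
      proof (induction n rule: dec_induct)
        case (step n)
        then show ?case using N[of n] m by simp
      qed (use m in simp)
      then show ?thesis by (auto simp: eventually_sequentially)
    qed
  qed
qed

text \<open>Taking the least code in the countable state space, rather than an arbitrary choice,
  makes the limit measurable. Its value matters only on paths that are eventually constant.\<close>

definition Zlim :: "'a \<Rightarrow> nat option" where
  "Zlim \<omega> = from_nat (LEAST i. \<forall>\<^sub>F n in sequentially. Z n \<omega> = from_nat i)"

lemma measurable_Zlim [measurable]: "Zlim \<in> measurable M (count_space UNIV)"
  unfolding Zlim_def eventually_sequentially by measurable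

lemma AE_Zlim:
  assumes "0 < Alim"
  shows "AE \<omega> in M. \<forall>\<^sub>F n in sequentially. Z n \<omega> = Zlim \<omega>"
  using AE_eventually_constant[OF assms]
proof eventually_elim
  case (elim \<omega>)
  then obtain l where "\<forall>\<^sub>F n in sequentially. Z n \<omega> = l" by blast
  then have "\<forall>\<^sub>F n in sequentially. Z n \<omega> = from_nat (to_nat l)" by simp
  then show ?case unfolding Zlim_def by (rule LeastI)
qed

text \<open>Almost surely \<open>opow s (Z n \<omega>)\<close> is eventually equal to
  \<open>opow s (Zlim \<omega>)\<close>, so bounded convergence identifies the limit of
  \<open>F n s\<close>.\<close>

lemma expectation_opow_Zlim:
  assumes "0 < Alim" "s \<in> {0..1}"
  shows "expectation (\<lambda>\<omega>. opow s (Zlim \<omega>)) = 1 - (Alim * (1 - s) powr (1/\<alpha>) + Clim) powr \<alpha>"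
proof (rule LIMSEQ_unique)
  have "(\<lambda>n. expectation (\<lambda>\<omega>. opow s (Z n \<omega>))) \<longlonglongrightarrow> expectation (\<lambda>\<omega>. opow s (Zlim \<omega>))"
  proof (rule integral_dominated_convergence[where w = "\<lambda>_. 1"])
    show "AE \<omega> in M. (\<lambda>n. opow s (Z n \<omega>)) \<longlonglongrightarrow> opow s (Zlim \<omega>)"
      using AE_Zlim[OF assms(1)]
      by eventually_elim (auto intro!: tendsto_eventually elim!: eventually_mono)
  qed (use assms(2) in \<open>auto simp: opow_bounds\<close>)
  then show "(\<lambda>n. F n s) \<longlonglongrightarrow> expectation (\<lambda>\<omega>. opow s (Zlim \<omega>))"
    using assms(2) by (simp add: expectation_opow_Z)
qed (rule F_lim)

lemma set_integral_Zlim: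
  assumes "0 < Alim" "s \<in> {0..1}"
  shows "(LINT \<omega>:{\<omega> \<in> space M. Zlim \<omega> \<noteq> None}|M. s ^ the (Zlim \<omega>)) =
    1 - (Alim * (1 - s) powr (1/\<alpha>) + Clim) powr \<alpha>"
proof -
  have "(LINT \<omega>:{\<omega> \<in> space M. Zlim \<omega> \<noteq> None}|M. s ^ the (Zlim \<omega>)) = expectation (\<lambda>\<omega>. opow s (Zlim \<omega>))"
    unfolding set_lebesgue_integral_def
    by (rule Bochner_Integration.integral_cong) (auto simp: opow_def indicator_def)
  then show ?thesis by (simp add: expectation_opow_Zlim[OF assms])
qed

lemma prob_Zlim_None:
  assumes "0 < Alim"
  shows "prob {\<omega> \<in> space M. Zlim \<omega> = None} = Clim powr \<alpha>"
proof -
  have "prob {\<omega> \<in> space M. Zlim \<omega> \<noteq> None} = 1 - Clim powr \<alpha>"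
    using set_integral_Zlim[OF assms, of 1] by (simp add: set_lebesgue_integral_def)
  moreover have "prob {\<omega> \<in> space M. Zlim \<omega> \<noteq> None} = 1 - prob {\<omega> \<in> space M. Zlim \<omega> = None}"
    by (subst prob_compl[symmetric]) (auto intro!: arg_cong[where f = prob])
  ultimately show ?thesis by simp
qed

end

text \<open>Unpacks the existential definitions into the locale. The exponent
  \<open>- \<theta>\<close> of the generating function turns into \<open>1/\<alpha>\<close> for
  \<open>\<alpha> = - 1 / \<theta>\<close>.\<close>

lemma GW_theta_process_exists:
  assumes "-1 < \<theta>" "\<theta> < 0"
    and "\<And>n. n \<ge> 1 \<Longrightarrow> 0 < a n \<and> a n < 1"
    and "\<And>n. n \<ge> 1 \<Longrightarrow> 0 < c n \<and> c n \<le> 1 - a n"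
    and "GW_theta M \<theta> a c Z"
  shows "\<exists>p X. GW_theta_process (- 1 / \<theta>) a c M p X Z"
proof -
  obtain p where p: "\<forall>n\<ge>1. \<forall>j. 0 \<le> p n j"
    "\<forall>n\<ge>1. \<forall>s\<in>{0..1}. (\<lambda>j. p n j * s ^ j) sums gw_f \<theta> a c n s" "defective_GWVE M p Z"
    using assms(5) unfolding GW_theta_def by blast
  from p(3) obtain X where X: "prob_space M"
    "prob_space.indep_vars M (\<lambda>_. count_space UNIV) (\<lambda>(n, i). X n i) ({1..} \<times> UNIV)"
    "\<forall>n\<ge>1. \<forall>i j. measure M {\<omega> \<in> space M. X n i \<omega> = Some j} = p n j"
    "\<forall>\<omega>\<in>space M. Z 0 \<omega> = Some 1"
    "\<forall>n\<ge>1. \<forall>\<omega>\<in>space M. Z n \<omega> = (case Z (n - 1) \<omega> of None \<Rightarrow> None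
        | Some k \<Rightarrow> if \<exists>i<k. X n i \<omega> = None then None else Some (\<Sum>i<k. the (X n i \<omega>)))"
    unfolding defective_GWVE_def by blast
  interpret prob_space M by (rule X(1))
  have "GW_theta_process (- 1 / \<theta>) a c M p X Z"
  proof
    show "1 < - 1 / \<theta>" using assms(1,2) by (simp add: field_simps)
    show "Z (Suc n) \<omega> = (case Z n \<omega> of None \<Rightarrow> None | Some k \<Rightarrow> offspring_total k (\<lambda>i. X (Suc n) i \<omega>))"
      if "\<omega> \<in> space M" for n \<omega>
      using X(5)[rule_format, of "Suc n" \<omega>] that
      by (auto simp: offspring_total_def split: option.split)
    show "(\<lambda>j. p n j * s ^ j) sums (1 - (a n * (1 - s) powr (1/(- 1 / \<theta>)) + c n) powr (- 1 / \<theta>))"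
      if "1 \<le> n" "s \<in> {0..1}" for n s
      using p(2)[rule_format, OF that] by (simp add: gw_f_def)
  qed (use assms X p in auto)
  then show ?thesis by blast
qed

theorem theorem10:
  fixes M :: "'a measure"
    and Z :: "nat \<Rightarrow> 'a \<Rightarrow> nat option"
    and a c :: "nat \<Rightarrow> real"
    and \<theta> \<alpha> A C q q\<^sub>\<Delta> Q :: real
  assumes "-1 < \<theta>" and "\<theta> < 0" and "\<alpha> = - 1 / \<theta>"
    and "\<And>n. n \<ge> 1 \<Longrightarrow> 0 < a n \<and> a n < 1"
    and "\<And>n. n \<ge> 1 \<Longrightarrow> 0 < c n \<and> c n \<le> 1 - a n"
    and "GW_theta M \<theta> a c Z"
    and "A = lim (gw_A a)"
    and "C = lim (gw_C a c)"
    and "q = measure M {\<omega> \<in> space M. tau_0 Z \<omega> < \<infinity>}"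
    and "q\<^sub>\<Delta> = measure M {\<omega> \<in> space M. tau_Delta Z \<omega> < \<infinity>}"
    and "Q = measure M {\<omega> \<in> space M. tau Z \<omega> < \<infinity>}"
  shows "\<alpha> > 1 \<and>
    gw_A a \<longlonglongrightarrow> A \<and> 0 \<le> A \<and> A < 1 \<and>
    gw_C a c \<longlonglongrightarrow> C \<and> 0 < C \<and> C \<le> 1 - A \<and>
    q = 1 - (A + C) powr \<alpha> \<and>
    q\<^sub>\<Delta> = C powr \<alpha> \<and>
    Q = 1 - (A + C) powr \<alpha> + C powr \<alpha> \<and>
    (A = 0 \<longrightarrow>
      q = 1 - q\<^sub>\<Delta> \<and> 1 - q\<^sub>\<Delta> = 1 - C powr \<alpha> \<and> Q = 1 \<and>
      (\<lambda>n. inverse (gw_A a n) * measure M {\<omega> \<in> space M. tau Z \<omega> > enat n})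
        \<longlonglongrightarrow> \<alpha> * C powr (\<alpha> - 1) \<and>
      (\<forall>s\<in>{0..1}.
        (\<lambda>n. (LINT \<omega>:{\<omega> \<in> space M. tau Z \<omega> > enat n}|M. s ^ the (Z n \<omega>))
              / measure M {\<omega> \<in> space M. tau Z \<omega> > enat n})
          \<longlonglongrightarrow> 1 - (1 - s) powr (1 / \<alpha>))) \<and>
    (0 < A \<and> A < 1 \<longrightarrow>
      Q < 1 \<and>
      (\<forall>n\<ge>1. (\<integral>\<^sup>+\<omega>\<in>{\<omega> \<in> space M. tau_Delta Z \<omega> > enat n}. of_nat (the (Z n \<omega>)) \<partial>M) = \<infinity>) \<and>
      (\<exists>Zlim :: 'a \<Rightarrow> nat option.
        Zlim \<in> measurable M (count_space UNIV) \<and>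
        (AE \<omega> in M. limitin (discrete_topology UNIV) (\<lambda>n. Z n \<omega>) (Zlim \<omega>) sequentially) \<and>
        measure M {\<omega> \<in> space M. Zlim \<omega> = None} = C powr \<alpha> \<and>
        (\<forall>s\<in>{0..1}.
          (LINT \<omega>:{\<omega> \<in> space M. Zlim \<omega> \<noteq> None}|M. s ^ the (Zlim \<omega>))
            = 1 - (A * (1 - s) powr (1 / \<alpha>) + C) powr \<alpha>)))"
proof -
  obtain p X where "GW_theta_process (- 1 / \<theta>) a c M p X Z"
    using GW_theta_process_exists[OF assms(1,2,4,5,6)] by blast
  then interpret GW_theta_process \<alpha> a c M p X Z
    using assms(3) by simp
  note q = prob_tau_0[folded assms(7,8,9)] and qD = prob_tau_Delta[folded assms(8,10)]
  have Q: "Q = 1 - (A + C) powr \<alpha> + C powr \<alpha>"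
    using prob_tau_finite q qD assms(9,10,11) by simp
  note lims = A_lim[folded assms(7)] C_lim[folded assms(8)] A_lim_nonneg[folded assms(7)]
    A_lim_less_1[folded assms(7)] C_lim_pos[folded assms(8)] A_plus_C_lim_le[folded assms(7,8)]
  \<comment> \<open>For positive \<open>A\<close>, strict monotonicity of the power gives
    \<open>C powr \<alpha> < (A + C) powr \<alpha>\<close>.\<close>
  have "Q < 1" if "0 < A"
    using that \<alpha> lims powr_less_mono2[of \<alpha> C "A + C"] by (simp add: Q)
  moreover have "\<exists>Zlim :: 'a \<Rightarrow> nat option.
        Zlim \<in> measurable M (count_space UNIV) \<and>
        (AE \<omega> in M. limitin (discrete_topology UNIV) (\<lambda>n. Z n \<omega>) (Zlim \<omega>) sequentially) \<and>
        prob {\<omega> \<in> space M. Zlim \<omega> = None} = C powr \<alpha> \<and>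
        (\<forall>s\<in>{0..1}.
          (LINT \<omega>:{\<omega> \<in> space M. Zlim \<omega> \<noteq> None}|M. s ^ the (Zlim \<omega>))
            = 1 - (A * (1 - s) powr (1 / \<alpha>) + C) powr \<alpha>)" if "0 < A"
  proof (intro exI[of _ Zlim] conjI ballI)
    have pos: "0 < lim (gw_A a)" using that assms(7) by simp
    \<comment> \<open>Eventual equality with the limit puts \<open>Z n \<omega>\<close> into every
      open set containing it.\<close>
    show "AE \<omega> in M. limitin (discrete_topology UNIV) (\<lambda>n. Z n \<omega>) (Zlim \<omega>) sequentially"
      using AE_Zlim[OF pos] by eventually_elim (auto simp: limitin_def elim!: eventually_mono)
    show "prob {\<omega> \<in> space M. Zlim \<omega> = None} = C powr \<alpha>"
      using prob_Zlim_None[OF pos] assms(8) by simp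
    show "(LINT \<omega>:{\<omega> \<in> space M. Zlim \<omega> \<noteq> None}|M. s ^ the (Zlim \<omega>))
            = 1 - (A * (1 - s) powr (1 / \<alpha>) + C) powr \<alpha>" if "s \<in> {0..1}" for s
      using set_integral_Zlim[OF pos that] assms(7,8) by simp
  qed measurable
  ultimately show ?thesis
    using \<alpha> lims q qD Q survival_asymp conditional_limit infinite_mean assms(7,8)
    by (intro conjI impI) auto
qed

end
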